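(* Let $\alpha>-2$. Let $\nu$ be a random variable with values in $\{1,2,\ldots\}$ such that $\mathbb{E}(t^\nu)<\infty$ for some $t>1$, and $m:=\mathbb{E}(\nu)>1$. Let $Y_0$ be a random variable with values in $(0,\infty)$ for which there exist constants $0<c_3\le c_4<\infty$ such that for all sufficiently large $x$, $$c_3\,x^\alpha\, m^{-x}\le \mathbb{P}(Y_0\ge x)\le c_4\,x^\alpha\, m^{-x}.$$ For $p\in[0,1]$, let $F_\infty(p)$ be the free energy of the recursive model with offspring variable $\nu$ and initial law $(1-p)\delta_0+pP_{Y_0}$, and let $p_c$ be its critical parameter. Then $p_c=0$ and $$F_\infty(p)=\exp\Big(-\frac{1}{p^{\chi+o(1)}}\Big),\qquad p\downarrow 0,$$ where $\chi=\chi(\alpha):=\frac{1}{\alpha+2}$ and $o(1)$ denotes a function of $p$ tending to $0$ as $p\downarrow 0$.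
   Context: The model: $\nu$ takes values in $\{1,2,\ldots\}$ with $m:=\mathbb{E}(\nu)\in(1,\infty)$. Let $Y_0$ be a random variable with values in $(0,\infty)$, $P_{Y_0}$ its law, $\delta_0$ the Dirac measure at $0$, and $p\in[0,1]$. The random variable $X_0\ge 0$ has law $(1-p)\delta_0+pP_{Y_0}$, and the laws of $X_n$ are defined recursively by: for all $n\ge 0$, $$X_{n+1}\ \overset{\mathrm{law}}{=}\ (X_{n,1}+\cdots+X_{n,\nu}-1)^+,$$ where $X_{n,1},X_{n,2},\ldots$ are independent copies of $X_n$, independent of $\nu$, and $a^+:=\max\{a,0\}$. The free energy is $F_\infty(p):=\lim_{n\to\infty}\mathbb{E}(X_n)/m^n$, where the sequence $\mathbb{E}(X_n)/m^n$ is non-increasing in $n$. The function $p\mapsto F_\infty(p)$ is non-decreasing, and the critical parameter $p_c\in[0,1]$ is the number such that $F_\infty(p)>0$ if $p>p_c$ and $F_\infty(p)=0$ if $p<p_c$ (so $p_c=0$ means $F_\infty(p)>0$ for all $p>0$, and $p_c=1$ means $F_\infty(p)=0$ for all $p<1$). *)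

theory Defs
  imports "HOL-Probability.Probability"
begin

text \<open>
  Throughout, \<open>N\<close> is the law of the offspring variable (a probability measure on the discrete
  space of natural numbers) and \<open>Q\<close> the law of \<open>Y\<^sub>0\<close> (a Borel probability measure on the reals).
\<close>

definition initial_law :: "real measure \<Rightarrow> real \<Rightarrow> real measure" where
  "initial_law Q p =
     measure_of UNIV (sets borel)
       (\<lambda>A. ennreal (1 - p) * emeasure (return borel 0) A + ennreal p * emeasure Q A)"

text \<open>
  The number of summands and the summands are the coordinates of a product space, hence
  independent. The summands are indexed from \<open>0\<close>.
\<close>

definition next_law :: "nat measure \<Rightarrow> real measure \<Rightarrow> real measure" where
  "next_law N \<mu> =
     distr (N \<Otimes>\<^sub>M Pi\<^sub>M (UNIV :: nat set) (\<lambda>_. \<mu>)) borel (\<lambda>(k, x). max ((\<Sum>i<k. x i) - 1) 0)"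

primrec law_at :: "nat measure \<Rightarrow> real measure \<Rightarrow> nat \<Rightarrow> real measure" where
  "law_at N \<mu> 0 = \<mu>"
| "law_at N \<mu> (Suc n) = next_law N (law_at N \<mu> n)"

text \<open>
  The Bochner integral and \<open>lim\<close> are meaningful when \<open>N\<close> and \<open>Q\<close> have finite mean: then all
  \<open>X\<^sub>n\<close> are integrable, and the sequence below is non-increasing and bounded below by \<open>0\<close>.
\<close>

definition free_energy :: "nat measure \<Rightarrow> real measure \<Rightarrow> real \<Rightarrow> real" where
  "free_energy N Q p =
     lim (\<lambda>n. (\<integral>x. x \<partial>law_at N (initial_law Q p) n) / (\<integral>k. real k \<partial>N) ^ n)"

definition critical_parameter :: "nat measure \<Rightarrow> real measure \<Rightarrow> real" where
  "critical_parameter N Q =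
     (THE c. c \<in> {0..1} \<and>
        (\<forall>p\<in>{0..1}. (c < p \<longrightarrow> free_energy N Q p > 0) \<and> (p < c \<longrightarrow> free_energy N Q p = 0)))"

lemma sets_initial_law [measurable_cong, simp]: "sets (initial_law Q p) = sets borel"
  by (simp add: initial_law_def sigma_algebra.sets_measure_of_eq[OF sets.sigma_algebra_axioms[of borel, simplified]])

lemma space_initial_law [simp]: "space (initial_law Q p) = UNIV"
  by (simp add: initial_law_def)

lemma emeasure_initial_law:
  assumes "sets Q = sets borel" and A: "A \<in> sets borel"
  shows "emeasure (initial_law Q p) A =
    ennreal (1 - p) * emeasure (return borel 0) A + ennreal p * emeasure Q A"
proof (rule emeasure_measure_of[OF initial_law_def])
  show "countably_additive (sets (initial_law Q p))
     (\<lambda>A. ennreal (1 - p) * emeasure (return borel 0) A + ennreal p * emeasure Q A)"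
    unfolding countably_additive_def
  proof (intro allI impI)
    fix B :: "nat \<Rightarrow> real set"
    assume B: "range B \<subseteq> sets (initial_law Q p)" and d: "disjoint_family B"
    have "(\<Sum>i. emeasure (return borel (0::real)) (B i)) = emeasure (return borel 0) (\<Union>i. B i)"
      "(\<Sum>i. emeasure Q (B i)) = emeasure Q (\<Union>i. B i)"
      using suminf_emeasure[of B "return borel (0::real)"] suminf_emeasure[of B Q] B d assms(1)
      by (simp_all del: emeasure_return)
    then show "(\<Sum>i. ennreal (1 - p) * emeasure (return borel 0) (B i) + ennreal p * emeasure Q (B i)) =
        ennreal (1 - p) * emeasure (return borel 0) (\<Union>i. B i) + ennreal p * emeasure Q (\<Union>i. B i)"
      by (simp add: suminf_add[symmetric] del: emeasure_return)
  qed
qed (use A in \<open>auto simp: positive_def\<close>)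

lemma prob_space_initial_law:
  assumes "prob_space Q" "sets Q = sets borel" "p \<in> {0..1}"
  shows "prob_space (initial_law Q p)"
proof
  have "space Q = UNIV" using sets_eq_imp_space_eq[OF assms(2)] by simp
  then have "emeasure Q UNIV = 1" using prob_space.emeasure_space_1[OF assms(1)] by simp
  then show "emeasure (initial_law Q p) (space (initial_law Q p)) = 1"
    using assms(3) by (simp add: emeasure_initial_law[OF assms(2)] flip: ennreal_plus)
qed

lemma prob_space_law_at:
  assumes N: "prob_space N" "sets N = UNIV" and \<mu>: "prob_space \<mu>" "sets \<mu> = sets borel"
  shows "prob_space (law_at N \<mu> n) \<and> sets (law_at N \<mu> n) = sets borel"
proof (induction n)
  case (Suc n)
  let ?P = "Pi\<^sub>M (UNIV :: nat set) (\<lambda>_. law_at N \<mu> n)"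
  have sN: "sets N = sets (count_space UNIV)" using N(2) by simp
  have sP: "sets ?P = sets (Pi\<^sub>M (UNIV :: nat set) (\<lambda>_. borel))"
    using Suc by (intro sets_PiM_cong) auto
  interpret P: product_prob_space "\<lambda>_. law_at N \<mu> n" "UNIV :: nat set"
    using Suc by (intro product_prob_spaceI) auto
  interpret P': prob_space ?P by (rule P.prob_space_axioms)
  interpret N: prob_space N by (rule N(1))
  interpret NP: pair_prob_space N ?P ..
  have "(\<lambda>(k, x). max ((\<Sum>i<k. x i) - 1) 0)
     \<in> borel_measurable (count_space (UNIV :: nat set) \<Otimes>\<^sub>M Pi\<^sub>M (UNIV :: nat set) (\<lambda>_. borel :: real measure))"
    unfolding split_beta'
    by (rule measurable_pair_measure_countable1) auto
  then have "(\<lambda>(k, x). max ((\<Sum>i<k. x i) - 1) 0) \<in> borel_measurable (N \<Otimes>\<^sub>M ?P)"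
    by (simp cong: measurable_cong_sets add: measurable_cong_sets[OF sets_pair_measure_cong[OF sN sP] refl])
  then show ?case
    by (simp add: next_law_def NP.prob_space_distr)
qed (use \<mu> in simp)

end

theory Submission
  imports Defs "HOL-Real_Asymp.Real_Asymp"
begin

text \<open>
  Fix \<open>s = m exp (-1/L)\<close> and follow \<open>D\<^sub>n = E (X\<^sub>n s\<^bsup>X\<^sub>n\<^esup>)\<close>, which is of order \<open>p L\<^bsup>\<alpha>+2\<^esup>\<close> for \<open>n = 0\<close>.
  One step of the recursion multiplies \<open>D\<^sub>n\<close> by \<open>m/s\<close>, up to a loss caused by the mass absorbed at \<open>0\<close> and a
  gain caused by merging, the gain being about \<open>D\<^sub>n\<close> times the loss.

  If \<open>D\<^sub>0\<close> is small, the loss wins, so \<open>D\<^sub>L \<le> e D\<^sub>0\<close>; hence \<open>E X\<^sub>L \<le> 1\<close> and \<open>F \<le> m\<^bsup>-L\<^esup>\<close>.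
  If \<open>D\<^sub>0\<close> is large, the gain wins and \<open>D\<^sub>n\<close> grows exponentially at rate of order \<open>1/L\<close>. On the other hand
  \<open>E X\<^sub>n\<^sub>+\<^sub>k \<ge> m\<^sup>k E (X\<^sub>n - k)\<^sup>+\<close>, so as long as the means stay bounded \<open>P(X\<^sub>n > k)\<close> is of order \<open>m\<^bsup>-k\<^esup>\<close> and
  \<open>D\<^sub>n\<close> is polynomially bounded in \<open>L\<close>. Hence some mean with index at most \<open>L\<^bsup>1+\<delta>\<^esup>\<close> exceeds \<open>1/(m-1) + 1\<close>, after
  which the means grow like \<open>m\<^sup>n\<close>. The threshold \<open>p L\<^bsup>\<alpha>+2\<^esup> = 1\<close> between the two regimes gives the exponent.
\<close>

section \<open>Integrals with respect to the recursion\<close>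

text \<open>At \<open>s = m\<close> the moment of \<open>Q\<close> compares with the series of
  k^(alpha+1), which diverges for alpha > -2. For \<open>s = m exp (-1/L)\<close> the extra factor
  exp(-k/L) cuts this series off at k of order L, whence the power alpha+2. The price is a drift
  \<open>m / s = exp (1/L)\<close> per step, which amounts to a factor e over L steps.

  Loss and gain are comparable because the loss, the integral of \<open>min x 1 * s powr x\<close>,
  and the excess over 1 of the integral of \<open>s powr x\<close> bound each other up to constants
  (\<open>powr_diff_one_le\<close> and \<open>min_powr_le\<close>), while the gain is of the order
  of the moment times this excess. So only the size of the moment decides which of them wins.

  In the growing regime a block of L steps gains a constant factor. Beating a polynomial bound would
  take a number of blocks of order log L; the proof uses about L^delta blocks with arbitrary delta >
  0. In the other regime the initial moment is only bounded by L^beta with beta > alpha+2. Both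
  concessions change the exponent by an arbitrarily small amount and disappear in the o(1).\<close>

definition nonneg_law :: "real measure \<Rightarrow> bool" where
  "nonneg_law \<mu> \<longleftrightarrow> prob_space \<mu> \<and> sets \<mu> = sets borel \<and> (AE x in \<mu>. 0 \<le> x)"

text \<open>This is \<open>s\<close> times the derivative of \<open>s powr x\<close> in
  \<open>s\<close>, so its integral is \<open>s\<close> times the derivative of the generating
  function of the law. It vanishes at 0, so the moment of the initial law is exactly
  \<open>p\<close> times that of \<open>Q\<close>.\<close>

definition moment_fun :: "real \<Rightarrow> real \<Rightarrow> real" where
  "moment_fun s x = x * s powr x"

abbreviation copies :: "real measure \<Rightarrow> (nat \<Rightarrow> real) measure" where
  "copies \<mu> \<equiv> Pi\<^sub>M UNIV (\<lambda>_. \<mu>)"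

lemma sets_copies:
  assumes "sets \<mu> = sets borel"
  shows "sets (copies \<mu>) = sets (copies borel)"
  using assms by (intro sets_PiM_cong) auto

lemma prob_space_copies: "nonneg_law \<mu> \<Longrightarrow> prob_space (copies \<mu>)"
  unfolding nonneg_law_def by (intro prob_space_PiM) auto

lemma AE_copies_nonneg:
  assumes "nonneg_law \<mu>"
  shows "AE x in copies \<mu>. \<forall>i. 0 \<le> x i"
  using assms unfolding nonneg_law_def
  by (subst AE_all_countable) (auto intro!: AE_PiM_component)

lemma nn_integral_copies_component:
  assumes "nonneg_law \<mu>" and [measurable]: "\<phi> \<in> borel_measurable borel"
  shows "(\<integral>\<^sup>+x. \<phi> (x i) \<partial>copies \<mu>) = (\<integral>\<^sup>+y. \<phi> y \<partial>\<mu>)"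
proof -
  have s[measurable_cong]: "sets \<mu> = sets borel" using assms by (simp add: nonneg_law_def)
  have "distr (copies \<mu>) \<mu> (\<lambda>x. x i) = \<mu>"
    using assms(1) by (intro distr_PiM_component) (auto simp: nonneg_law_def)
  then have "(\<integral>\<^sup>+y. \<phi> y \<partial>\<mu>) = (\<integral>\<^sup>+y. \<phi> y \<partial>distr (copies \<mu>) \<mu> (\<lambda>x. x i))" by simp
  also have "\<dots> = (\<integral>\<^sup>+x. \<phi> (x i) \<partial>copies \<mu>)"
    by (intro nn_integral_distr) measurable
  finally show ?thesis by simp
qed

text \<open>Only \<open>k\<close> coordinates of the infinite product occur. Restriction to them
  maps the infinite product measure to the finite one, where Fubini applies.\<close>

lemma nn_integral_copies_prod:
  fixes \<phi> :: "nat \<Rightarrow> real \<Rightarrow> ennreal"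
  assumes "nonneg_law \<mu>" and [measurable]: "\<And>i. \<phi> i \<in> borel_measurable borel"
  shows "(\<integral>\<^sup>+x. (\<Prod>i<k. \<phi> i (x i)) \<partial>copies \<mu>) = (\<Prod>i<k. \<integral>\<^sup>+y. \<phi> i y \<partial>\<mu>)"
proof -
  have s[measurable_cong]: "sets \<mu> = sets borel" using assms by (simp add: nonneg_law_def)
  interpret P: product_prob_space "\<lambda>_. \<mu>" "UNIV :: nat set"
    using assms(1) by (intro product_prob_spaceI) (auto simp: nonneg_law_def)
  have "(\<Prod>i<k. \<integral>\<^sup>+y. \<phi> i y \<partial>\<mu>) = (\<integral>\<^sup>+x. (\<Prod>i<k. \<phi> i (x i)) \<partial>Pi\<^sub>M {..<k} (\<lambda>_. \<mu>))"
    by (intro P.product_nn_integral_prod[symmetric]) auto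
  also have "\<dots> = (\<integral>\<^sup>+x. (\<Prod>i<k. \<phi> i (x i)) \<partial>distr (copies \<mu>) (Pi\<^sub>M {..<k} (\<lambda>_. \<mu>)) (\<lambda>x. restrict x {..<k}))"
    using assms(1) by (subst distr_PiM_reindex[of UNIV "\<lambda>_. \<mu>" "\<lambda>i. i" "{..<k}"]) (auto simp: nonneg_law_def)
  also have "\<dots> = (\<integral>\<^sup>+x. (\<Prod>i<k. \<phi> i (x i)) \<partial>copies \<mu>)"
    by (subst nn_integral_distr) (auto intro!: nn_integral_cong prod.cong)
  finally show ?thesis by simp
qed

lemma next_law_measurable:
  fixes N :: "nat measure"
  assumes "sets N = UNIV" "sets \<mu> = sets borel"
  shows "(\<lambda>(k, x). max ((\<Sum>i<k. x i) - 1) 0) \<in> borel_measurable (N \<Otimes>\<^sub>M copies \<mu>)"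
proof -
  have sN: "sets N = sets (count_space UNIV)" using assms by simp
  have "(\<lambda>(k, x). max ((\<Sum>i<k. x i) - 1) 0)
     \<in> borel_measurable (count_space (UNIV :: nat set) \<Otimes>\<^sub>M copies (borel :: real measure))"
    unfolding split_beta' by (rule measurable_pair_measure_countable1) auto
  then show ?thesis
    by (simp cong: measurable_cong_sets
        add: measurable_cong_sets[OF sets_pair_measure_cong[OF sN sets_copies[OF assms(2)]] refl])
qed

lemma nn_integral_next_law:
  fixes N :: "nat measure"
  assumes N: "prob_space N" "sets N = UNIV" and \<mu>: "nonneg_law \<mu>" and f: "f \<in> borel_measurable borel"
  shows "(\<integral>\<^sup>+x. f x \<partial>next_law N \<mu>) = (\<integral>\<^sup>+k. \<integral>\<^sup>+x. f (max ((\<Sum>i<k. x i) - 1) 0) \<partial>copies \<mu> \<partial>N)"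
proof -
  have s: "sets \<mu> = sets borel" using \<mu> by (simp add: nonneg_law_def)
  note [measurable] = next_law_measurable[OF N(2) s] f
  interpret P: prob_space "copies \<mu>" by (rule prob_space_copies[OF \<mu>])
  have "(\<integral>\<^sup>+x. f x \<partial>next_law N \<mu>) = (\<integral>\<^sup>+z. f (case z of (k, x) \<Rightarrow> max ((\<Sum>i<k. x i) - 1) 0) \<partial>(N \<Otimes>\<^sub>M copies \<mu>))"
    unfolding next_law_def by (rule nn_integral_distr) measurable
  also have "\<dots> = (\<integral>\<^sup>+k. \<integral>\<^sup>+x. f (max ((\<Sum>i<k. x i) - 1) 0) \<partial>copies \<mu> \<partial>N)"
    by (subst P.nn_integral_fst[symmetric]) simp_all
  finally show ?thesis .
qed

lemma nonneg_law_next_law: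
  fixes N :: "nat measure"
  assumes N: "prob_space N" "sets N = UNIV" and \<mu>: "nonneg_law \<mu>"
  shows "nonneg_law (next_law N \<mu>)"
proof -
  have s: "sets \<mu> = sets borel" "prob_space \<mu>" using \<mu> by (simp_all add: nonneg_law_def)
  have "AE x in next_law N \<mu>. 0 \<le> x"
    unfolding next_law_def using next_law_measurable[OF N(2) s(1)] by (subst AE_distr_iff) auto
  with prob_space_law_at[OF N s(2,1), of 1] show ?thesis by (simp add: nonneg_law_def)
qed

lemma nonneg_law_law_at:
  fixes N :: "nat measure"
  assumes "prob_space N" "sets N = UNIV" "nonneg_law \<mu>"
  shows "nonneg_law (law_at N \<mu> n)"
  by (induction n) (use assms nonneg_law_next_law in auto)

lemma nn_integral_copies_sum:
  assumes \<mu>: "nonneg_law \<mu>" and [measurable]: "\<phi> \<in> borel_measurable borel"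
  shows "(\<integral>\<^sup>+x. (\<Sum>i<k. \<phi> (x i)) \<partial>copies \<mu>) = of_nat k * (\<integral>\<^sup>+y. \<phi> y \<partial>\<mu>)"
proof -
  have s[measurable_cong]: "sets \<mu> = sets borel" using assms by (simp add: nonneg_law_def)
  have "(\<integral>\<^sup>+x. (\<Sum>i<k. \<phi> (x i)) \<partial>copies \<mu>) = (\<Sum>i<k. \<integral>\<^sup>+x. \<phi> (x i) \<partial>copies \<mu>)"
    by (intro nn_integral_sum) measurable
  also have "\<dots> = of_nat k * (\<integral>\<^sup>+y. \<phi> y \<partial>\<mu>)"
    by (simp add: nn_integral_copies_component[OF \<mu>])
  finally show ?thesis .
qed

text \<open>The function \<open>max (x - a) 0\<close> is convex on the half-line and vanishes at 0,
  hence superadditive there.\<close>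

lemma excess_superadditive:
  fixes x :: "nat \<Rightarrow> real"
  assumes "\<And>i. 0 \<le> x i" "1 \<le> k" "1 \<le> a"
  shows "(\<Sum>i<k. max (x i - a) 0) \<le> max ((\<Sum>i<k. x i) - a) 0"
proof -
  have "(\<Sum>i<j. max (x i - a) 0) \<le> max ((\<Sum>i<j. x i) - a) 0" for j
  proof (induction j)
    case (Suc j)
    have "0 \<le> sum x {..<j}" "0 \<le> x j" using assms(1) by (auto intro: sum_nonneg)
    with Suc assms(3) show ?case by (simp add: max_def split: if_splits)
  qed (use assms in auto)
  then show ?thesis .
qed

section \<open>One-step inequalities for means and excesses\<close>

locale offspring_law = prob_space N for N :: "nat measure" +
  fixes m t :: real
  assumes sets_N: "sets N = UNIV"
    and ge_1: "AE k in N. 1 \<le> k"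
    and integrable_id: "integrable N real"
    and mean: "(\<integral>k. real k \<partial>N) = m"
    and m_gt_1: "1 < m"
    and t_gt_1: "1 < t"
    and exp_moment: "integrable N (\<lambda>k. t ^ k)"
begin

lemma sets_N_count_space [measurable_cong]: "sets N = sets (count_space UNIV)"
  using sets_N by simp

lemma nn_mean: "(\<integral>\<^sup>+k. of_nat k \<partial>N) = ennreal m"
  using nn_integral_eq_integral[OF integrable_id] mean by (simp add: ennreal_of_nat_eq_real_of_nat)

lemmas nn_next = nn_integral_next_law[OF prob_space_axioms sets_N]
lemmas nonneg_next = nonneg_law_next_law[OF prob_space_axioms sets_N]
lemmas nonneg_at = nonneg_law_law_at[OF prob_space_axioms sets_N]

text \<open>Wald's identity: a pointwise comparison with an additive functional of the summands
  becomes the factor \<open>m\<close> between integrals.\<close>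

lemma nn_next_mono:
  assumes \<mu>: "nonneg_law \<mu>"
    and f[measurable]: "f \<in> borel_measurable borel" and g[measurable]: "g \<in> borel_measurable borel"
    and le: "\<And>(k::nat) x. 1 \<le> k \<Longrightarrow> (\<And>i. 0 \<le> x i) \<Longrightarrow> f (max ((\<Sum>i<k. x i) - 1) 0) \<le> (\<Sum>i<k. g (x i))"
  shows "(\<integral>\<^sup>+x. f x \<partial>next_law N \<mu>) \<le> ennreal m * (\<integral>\<^sup>+x. g x \<partial>\<mu>)"
proof -
  have "(\<integral>\<^sup>+x. f x \<partial>next_law N \<mu>) \<le> (\<integral>\<^sup>+k. \<integral>\<^sup>+x. (\<Sum>i<k. g (x i)) \<partial>copies \<mu> \<partial>N)"
    unfolding nn_next[OF \<mu> f]
  proof (intro nn_integral_mono_AE)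
    show "AE k in N. (\<integral>\<^sup>+x. f (max ((\<Sum>i<k. x i) - 1) 0) \<partial>copies \<mu>) \<le> (\<integral>\<^sup>+x. (\<Sum>i<k. g (x i)) \<partial>copies \<mu>)"
      using ge_1
    proof eventually_elim
      case (elim k)
      show ?case using AE_copies_nonneg[OF \<mu>]
        by (intro nn_integral_mono_AE) (auto elim!: eventually_mono intro: le[OF elim])
    qed
  qed
  also have "\<dots> = ennreal m * (\<integral>\<^sup>+x. g x \<partial>\<mu>)"
    by (simp add: nn_integral_copies_sum[OF \<mu>] nn_integral_multc nn_mean)
  finally show ?thesis .
qed

lemma nn_next_mono':
  assumes \<mu>: "nonneg_law \<mu>"
    and f[measurable]: "f \<in> borel_measurable borel" and g[measurable]: "g \<in> borel_measurable borel"
    and le: "\<And>(k::nat) x. 1 \<le> k \<Longrightarrow> (\<And>i. 0 \<le> x i) \<Longrightarrow> (\<Sum>i<k. g (x i)) \<le> f (max ((\<Sum>i<k. x i) - 1) 0)"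
  shows "ennreal m * (\<integral>\<^sup>+x. g x \<partial>\<mu>) \<le> (\<integral>\<^sup>+x. f x \<partial>next_law N \<mu>)"
proof -
  have "ennreal m * (\<integral>\<^sup>+x. g x \<partial>\<mu>) = (\<integral>\<^sup>+k. \<integral>\<^sup>+x. (\<Sum>i<k. g (x i)) \<partial>copies \<mu> \<partial>N)"
    by (simp add: nn_integral_copies_sum[OF \<mu>] nn_integral_multc nn_mean)
  also have "\<dots> \<le> (\<integral>\<^sup>+x. f x \<partial>next_law N \<mu>)"
    unfolding nn_next[OF \<mu> f]
  proof (intro nn_integral_mono_AE)
    show "AE k in N. (\<integral>\<^sup>+x. (\<Sum>i<k. g (x i)) \<partial>copies \<mu>) \<le> (\<integral>\<^sup>+x. f (max ((\<Sum>i<k. x i) - 1) 0) \<partial>copies \<mu>)"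
      using ge_1
    proof eventually_elim
      case (elim k)
      show ?case using AE_copies_nonneg[OF \<mu>]
        by (intro nn_integral_mono_AE) (auto elim!: eventually_mono intro: le[OF elim])
    qed
  qed
  finally show ?thesis .
qed

abbreviation nn_expect :: "real measure \<Rightarrow> ennreal" where
  "nn_expect \<mu> \<equiv> \<integral>\<^sup>+x. ennreal x \<partial>\<mu>"

lemma nn_expect_next_le:
  assumes "nonneg_law \<mu>"
  shows "nn_expect (next_law N \<mu>) \<le> ennreal m * nn_expect \<mu>"
proof (rule nn_next_mono[OF assms])
  fix k :: nat and x :: "nat \<Rightarrow> real" assume "\<And>i. 0 \<le> x i"
  then show "ennreal (max ((\<Sum>i<k. x i) - 1) 0) \<le> (\<Sum>i<k. ennreal (x i))"
    by (simp add: sum_nonneg)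
qed auto

text \<open>\<open>ennreal\<close> sends negative numbers to 0, so these are integrals of positive
  parts. The unit subtracted in a step raises the threshold from \<open>a\<close> to
  \<open>a + 1\<close>, and superadditivity distributes the excess over the summands.\<close>

lemma nn_excess_next_ge:
  assumes "nonneg_law \<mu>" "0 \<le> a"
  shows "ennreal m * (\<integral>\<^sup>+x. ennreal (x - (a + 1)) \<partial>\<mu>) \<le> (\<integral>\<^sup>+x. ennreal (x - a) \<partial>next_law N \<mu>)"
proof (rule nn_next_mono'[OF assms(1)])
  fix k :: nat and x :: "nat \<Rightarrow> real" assume x: "\<And>i. 0 \<le> x i" and k: "1 \<le> k"
  have "(\<Sum>i<k. ennreal (x i - (a + 1))) = ennreal (\<Sum>i<k. max (x i - (a + 1)) 0)"
    by (subst sum_ennreal[symmetric]) (auto intro!: sum.cong simp: max_def ennreal_neg simp del: sum_ennreal)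
  also have "\<dots> \<le> ennreal (max ((\<Sum>i<k. x i) - (a+1)) 0)"
    using excess_superadditive[OF x k, of "a+1"] assms(2) by (intro ennreal_leI) auto
  also have "\<dots> \<le> ennreal (max ((\<Sum>i<k. x i) - 1) 0 - a)"
    using assms(2) by (auto simp: max_def ennreal_neg)
  finally show "(\<Sum>i<k. ennreal (x i - (a + 1))) \<le> ennreal (max ((\<Sum>i<k. x i) - 1) 0 - a)" .
qed auto

lemma nn_expect_at_ge_excess:
  assumes "nonneg_law \<mu>"
  shows "ennreal (m ^ k) * (\<integral>\<^sup>+x. ennreal (x - real k) \<partial>law_at N \<mu> n) \<le> nn_expect (law_at N \<mu> (n + k))"
proof -
  \<comment> \<open>Each induction step raises the threshold by 1, so the induction needs
    \<open>a\<close> arbitrary although only \<open>a = 0\<close> is used afterwards.\<close>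
  have "ennreal (m ^ j) * (\<integral>\<^sup>+x. ennreal (x - (a + real j)) \<partial>law_at N \<mu> n) \<le> (\<integral>\<^sup>+x. ennreal (x - a) \<partial>law_at N \<mu> (n + j))"
    if "0 \<le> a" for j a using that
  proof (induction j arbitrary: a)
    case (Suc j)
    have "ennreal (m ^ Suc j) * (\<integral>\<^sup>+x. ennreal (x - (a + real (Suc j))) \<partial>law_at N \<mu> n)
       = ennreal m * (ennreal (m ^ j) * (\<integral>\<^sup>+x. ennreal (x - ((a + 1) + real j)) \<partial>law_at N \<mu> n))"
      using m_gt_1 by (simp add: ennreal_mult mult.assoc algebra_simps)
    also have "\<dots> \<le> ennreal m * (\<integral>\<^sup>+x. ennreal (x - (a + 1)) \<partial>law_at N \<mu> (n + j))"
      using Suc by (intro mult_left_mono) auto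
    also have "\<dots> \<le> (\<integral>\<^sup>+x. ennreal (x - a) \<partial>law_at N \<mu> (n + Suc j))"
      using nn_excess_next_ge[OF nonneg_at[OF assms] Suc.prems] by simp
    finally show ?case .
  qed simp
  from this[of 0 k] show ?thesis by simp
qed

text \<open>A step loses at most 1 in the mean. Divided by powers of \<open>m\<close> these losses
  are summable, which later bounds the free energy from below.\<close>

lemma nn_expect_next_ge:
  assumes "nonneg_law \<mu>"
  shows "ennreal m * nn_expect \<mu> \<le> nn_expect (next_law N \<mu>) + 1"
proof -
  interpret X: prob_space "next_law N \<mu>" using nonneg_next[OF assms] by (simp add: nonneg_law_def)
  have [measurable_cong]: "sets (next_law N \<mu>) = sets borel" by (simp add: next_law_def)
  have "ennreal m * nn_expect \<mu> \<le> (\<integral>\<^sup>+x. ennreal x + 1 \<partial>next_law N \<mu>)"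
  proof (rule nn_next_mono'[OF assms])
    fix k :: nat and x :: "nat \<Rightarrow> real" assume x: "\<And>i. 0 \<le> x i"
    have "(\<Sum>i<k. ennreal (x i)) \<le> ennreal (max ((\<Sum>i<k. x i) - 1) 0 + 1)"
      by (subst sum_ennreal[OF x]) (intro ennreal_leI, simp)
    also have "\<dots> = ennreal (max ((\<Sum>i<k. x i) - 1) 0) + 1" by (subst ennreal_plus) auto
    finally show "(\<Sum>i<k. ennreal (x i)) \<le> ennreal (max ((\<Sum>i<k. x i) - 1) 0) + 1" .
  qed auto
  also have "\<dots> = nn_expect (next_law N \<mu>) + 1"
    by (subst nn_integral_add) (auto simp: X.emeasure_space_1)
  finally show ?thesis .
qed

end

section \<open>Small exponential moments do not grow\<close>

text \<open>Mean value bound: on \<open>[1, h]\<close> the derivative of the power is at most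
  \<open>n * h ^ n\<close>.\<close>

lemma power_diff_one_le:
  fixes h :: real
  assumes "1 \<le> h"
  shows "h ^ n - 1 \<le> real n * (h - 1) * h ^ n"
proof (induction n)
  case (Suc n)
  have "h ^ Suc n - 1 = h * (h ^ n - 1) + (h - 1) * 1" by (simp add: algebra_simps)
  also have "\<dots> \<le> h * (real n * (h - 1) * h ^ n) + (h - 1) * h ^ Suc n"
    using Suc assms one_le_power[OF assms, of "Suc n"] by (intro add_mono mult_left_mono) auto
  finally show ?case by (simp add: algebra_simps)
qed simp

text \<open>Bounds what merging can produce by what is absorbed at 0. For \<open>x \<le> 1\<close>
  it follows from \<open>1 - s powr (- x) \<le> x * ln s\<close> and
  \<open>ln s \<le> s - 1\<close>, with \<open>m\<close> as a bound uniform in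
  \<open>s\<close>.\<close>

lemma powr_diff_one_le:
  fixes s x :: real
  assumes "1 < s" "s \<le> m" "0 \<le> x"
  shows "s powr x - 1 \<le> m * (min x 1 * s powr x)"
proof (cases "x \<le> 1")
  case True
  have "1 + (- x * ln s) \<le> exp (- x * ln s)" by (rule exp_ge_add_one_self)
  also have "\<dots> = s powr (- x)" using assms by (simp add: powr_def)
  finally have "1 - s powr (- x) \<le> x * ln s" by simp
  also have "\<dots> \<le> x * m" using ln_le_minus_one[of s] assms by (intro mult_left_mono) auto
  finally have "s powr x * (1 - s powr (- x)) \<le> s powr x * (x * m)" by (intro mult_left_mono) auto
  moreover have "s powr x * s powr (- x) = 1" using assms by (simp flip: powr_add)
  ultimately show ?thesis using True by (simp add: algebra_simps)
next
  case False
  have "s powr x - 1 \<le> 1 * s powr x" by simp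
  also have "\<dots> \<le> m * s powr x" using assms by (intro mult_right_mono) auto
  finally show ?thesis using False by simp
qed

text \<open>The exact balance of one subtraction: apart from the factor \<open>s\<close>, the moment
  loses \<open>min S 1 * s powr S\<close>. This term is the loss that the gain has to be compared
  with.\<close>

lemma moment_fun_pred:
  assumes "0 < s" "0 \<le> S"
  shows "s * moment_fun s (max (S - 1) 0) + min S 1 * s powr S = S * s powr S"
  using assms by (cases "S \<le> 1") (auto simp: moment_fun_def powr_diff max_def min_def field_simps)

lemma borel_measurable_moment_fun [measurable]: "moment_fun s \<in> borel_measurable borel"
  unfolding moment_fun_def by measurable

text \<open>The product rule for the \<open>k\<close>-th power of the generating function: in the
  \<open>i\<close>-th term, coordinate \<open>i\<close> carries \<open>moment_fun s\<close> and
  every other coordinate carries \<open>s powr\<close>.\<close>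

lemma nn_integral_copies_weighted_sum:
  assumes \<mu>: "nonneg_law \<mu>" and s: "0 < s"
  shows "(\<integral>\<^sup>+x. ennreal ((\<Sum>i<k. x i) * s powr (\<Sum>i<k. x i)) \<partial>copies \<mu>)
    = of_nat k * ((\<integral>\<^sup>+x. ennreal (moment_fun s x) \<partial>\<mu>) * (\<integral>\<^sup>+x. ennreal (s powr x) \<partial>\<mu>) ^ (k - 1))"
proof -
  have [measurable_cong]: "sets (copies \<mu>) = sets (copies borel)"
    using \<mu> by (intro sets_copies) (simp add: nonneg_law_def)
  define \<phi> where "\<phi> i j y = ennreal (if j = i then moment_fun s y else s powr y)" for i j :: nat and y
  have [measurable]: "\<phi> i j \<in> borel_measurable borel" for i j unfolding \<phi>_def by measurable
  have "(\<integral>\<^sup>+x. ennreal ((\<Sum>i<k. x i) * s powr (\<Sum>i<k. x i)) \<partial>copies \<mu>)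
     = (\<integral>\<^sup>+x. (\<Sum>i<k. \<Prod>j<k. \<phi> i j (x j)) \<partial>copies \<mu>)"
  proof (intro nn_integral_cong_AE, use AE_copies_nonneg[OF \<mu>] in eventually_elim)
    case (elim x)
    have "(\<Prod>j<k. \<phi> i j (x j)) = ennreal (x i * s powr (\<Sum>i<k. x i))" if "i < k" for i
    proof -
      have "(\<Prod>j<k. \<phi> i j (x j)) = ennreal (\<Prod>j<k. if j = i then moment_fun s (x j) else s powr x j)"
        unfolding \<phi>_def using elim by (intro prod_ennreal) (auto simp: moment_fun_def)
      also have "(\<Prod>j<k. if j = i then moment_fun s (x j) else s powr x j)
          = (\<Prod>j<k. (if j = i then x i else 1) * s powr x j)"
        by (intro prod.cong) (auto simp: moment_fun_def)
      also have "\<dots> = x i * s powr (\<Sum>i<k. x i)"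
        using that s by (simp add: prod.distrib powr_sum)
      finally show ?thesis .
    qed
    then show ?case using elim by (simp add: sum_distrib_right)
  qed
  also have "\<dots> = (\<Sum>i<k. \<Prod>j<k. \<integral>\<^sup>+y. \<phi> i j y \<partial>\<mu>)"
    by (subst nn_integral_sum) (auto simp: nn_integral_copies_prod[OF \<mu>])
  also have "\<dots> = (\<Sum>i<k. (\<integral>\<^sup>+x. ennreal (moment_fun s x) \<partial>\<mu>) * (\<integral>\<^sup>+x. ennreal (s powr x) \<partial>\<mu>) ^ (k - 1))"
  proof (intro sum.cong refl)
    fix i assume i: "i \<in> {..<k}"
    have "(\<Prod>j<k. \<integral>\<^sup>+y. \<phi> i j y \<partial>\<mu>) = (\<integral>\<^sup>+y. \<phi> i i y \<partial>\<mu>) * (\<Prod>j\<in>{..<k} - {i}. \<integral>\<^sup>+y. \<phi> i j y \<partial>\<mu>)"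
      using i by (intro prod.remove) auto
    also have "(\<Prod>j\<in>{..<k} - {i}. \<integral>\<^sup>+y. \<phi> i j y \<partial>\<mu>) = (\<Prod>j\<in>{..<k} - {i}. \<integral>\<^sup>+x. ennreal (s powr x) \<partial>\<mu>)"
      by (intro prod.cong) (auto simp: \<phi>_def)
    finally show "(\<Prod>j<k. \<integral>\<^sup>+y. \<phi> i j y \<partial>\<mu>) = (\<integral>\<^sup>+x. ennreal (moment_fun s x) \<partial>\<mu>) * (\<integral>\<^sup>+x. ennreal (s powr x) \<partial>\<mu>) ^ (k - 1)"
      using i by (simp add: \<phi>_def)
  qed
  finally show ?thesis by simp
qed

context offspring_law begin

text \<open>The integral is the derivative of the offspring generating function at \<open>h\<close>.
  It equals \<open>m\<close> at \<open>h = 1\<close> and grows at most linearly in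
  \<open>h - 1\<close> where second derivatives are controlled.\<close>

lemma size_biased_power_bound:
  "\<exists>C>0. \<forall>h\<in>{1..sqrt t}. (\<integral>\<^sup>+k. ennreal (real k * h ^ (k - 1)) \<partial>N) \<le> ennreal (m + C * (h - 1))"
proof -
  define u where "u = sqrt t"
  have u: "1 < u" "t = u * u" using t_gt_1 by (auto simp: u_def)
  \<comment> \<open>Going from \<open>t\<close> to its square root leaves a geometric factor that
    absorbs \<open>real k ^ 2\<close>.\<close>
  have "(\<lambda>k. real k ^ 2 / u ^ k) \<longlonglongrightarrow> 0" using u by real_asymp
  then have "Bseq (\<lambda>k. real k ^ 2 / u ^ k)" by (intro convergent_imp_Bseq convergentI)
  then obtain c where c: "0 < c" "\<And>k. norm (real k ^ 2 / u ^ k) \<le> c" by (auto elim!: BseqE)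
  have sq: "real k ^ 2 * u ^ k \<le> c * t ^ k" for k
  proof -
    have "real k ^ 2 \<le> c * u ^ k" using c(2)[of k] u by (simp add: field_simps)
    then show ?thesis using u by (simp add: power_mult_distrib mult_right_mono)
  qed
  have int: "integrable N (\<lambda>k. real k ^ 2 * u ^ k)"
  proof (rule Bochner_Integration.integrable_bound[OF integrable_mult_right[OF exp_moment, of c]])
    show "AE k in N. norm (real k ^ 2 * u ^ k) \<le> norm (c * t ^ k)"
      using sq u c t_gt_1 by (auto simp: abs_mult)
  qed auto
  define C where "C = (\<integral>k. real k ^ 2 * u ^ k \<partial>N) + 1"
  have C: "0 < C" unfolding C_def using u by (intro add_nonneg_pos Bochner_Integration.integral_nonneg) auto
  have "(\<integral>\<^sup>+k. ennreal (real k * h ^ (k - 1)) \<partial>N) \<le> ennreal (m + C * (h - 1))" if h: "h \<in> {1..u}" for h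
  proof -
    have pw: "real k * h ^ (k - 1) \<le> real k + (h - 1) * (real k ^ 2 * u ^ k)" for k
    proof (cases k)
      case (Suc n)
      have "h ^ n - 1 \<le> real n * (h - 1) * h ^ n" using h by (intro power_diff_one_le) auto
      also have "\<dots> \<le> real k * (h - 1) * u ^ k"
      proof (intro mult_mono)
        have "h ^ n \<le> u ^ n" using h by (intro power_mono) auto
        also have "\<dots> \<le> u ^ k" using u Suc by (intro power_increasing) auto
        finally show "h ^ n \<le> u ^ k" .
      qed (use h Suc in auto)
      finally have "real k * (h ^ n - 1) \<le> real k * (real k * (h - 1) * u ^ k)" by (intro mult_left_mono) auto
      then show ?thesis using Suc by (simp add: algebra_simps power2_eq_square)
    qed simp
    have "(\<integral>\<^sup>+k. ennreal (real k * h ^ (k - 1)) \<partial>N) \<le> (\<integral>\<^sup>+k. ennreal (real k + (h - 1) * (real k ^ 2 * u ^ k)) \<partial>N)"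
      by (intro nn_integral_mono ennreal_leI pw)
    also have "\<dots> = ennreal (\<integral>k. real k + (h - 1) * (real k ^ 2 * u ^ k) \<partial>N)"
      using h u by (intro nn_integral_eq_integral) (auto intro!: integrable_id int)
    also have "(\<integral>k. real k + (h - 1) * (real k ^ 2 * u ^ k) \<partial>N) = m + (C - 1) * (h - 1)"
      using int integrable_id by (simp add: mean C_def)
    also have "ennreal \<dots> \<le> ennreal (m + C * (h - 1))"
      using h by (intro ennreal_leI) (auto simp: algebra_simps)
    finally show ?thesis .
  qed
  with C show ?thesis unfolding u_def by blast
qed

text \<open>Integrates \<open>moment_fun_pred\<close> at the sum of the summands. The loss at the
  sum is at least the loss of summand 0, which exists since \<open>1 \<le> k\<close>; this makes the
  loss term independent of the number of summands.\<close>

lemma nn_moment_next_le: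
  assumes \<mu>: "nonneg_law \<mu>" and s: "1 < s"
  shows "ennreal s * (\<integral>\<^sup>+x. ennreal (moment_fun s x) \<partial>next_law N \<mu>) + (\<integral>\<^sup>+x. ennreal (min x 1 * s powr x) \<partial>\<mu>)
    \<le> (\<integral>\<^sup>+x. ennreal (moment_fun s x) \<partial>\<mu>) * (\<integral>\<^sup>+k. of_nat k * (\<integral>\<^sup>+x. ennreal (s powr x) \<partial>\<mu>) ^ (k - 1) \<partial>N)"
    (is "_ * _ + ?K \<le> ?D * (\<integral>\<^sup>+k. of_nat k * ?h ^ (k - 1) \<partial>N)")
proof -
  have [measurable_cong]: "sets (copies \<mu>) = sets (copies borel)"
    using \<mu> by (intro sets_copies) (simp add: nonneg_law_def)
  interpret P: prob_space "copies \<mu>" by (rule prob_space_copies[OF \<mu>])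
  let ?I = "\<lambda>k::nat. \<integral>\<^sup>+x. ennreal (moment_fun s (max ((\<Sum>i<k. x i) - 1) 0)) \<partial>copies \<mu>"
  have le: "ennreal s * ?I k + ?K \<le> ?D * (of_nat k * ?h ^ (k - 1))" if k: "1 \<le> k" for k
  proof -
    have "ennreal s * ?I k + ?K
       = (\<integral>\<^sup>+x. ennreal s * ennreal (moment_fun s (max ((\<Sum>i<k. x i) - 1) 0)) + ennreal (min (x 0) 1 * s powr (x 0)) \<partial>copies \<mu>)"
      by (subst nn_integral_add) (auto simp: nn_integral_cmult nn_integral_copies_component[OF \<mu>, of "\<lambda>x. ennreal (min x 1 * s powr x)" 0])
    also have "\<dots> \<le> (\<integral>\<^sup>+x. ennreal ((\<Sum>i<k. x i) * s powr (\<Sum>i<k. x i)) \<partial>copies \<mu>)"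
    proof (intro nn_integral_mono_AE, use AE_copies_nonneg[OF \<mu>] in eventually_elim)
      case (elim x)
      define S where "S = (\<Sum>i<k. x i)"
      have S: "0 \<le> S" "x 0 \<le> S" unfolding S_def using elim k by (auto intro: sum_nonneg member_le_sum)
      have "min (x 0) 1 * s powr (x 0) \<le> min S 1 * s powr S"
        using S s elim by (intro mult_mono powr_mono) auto
      then have "s * moment_fun s (max (S - 1) 0) + min (x 0) 1 * s powr (x 0) \<le> S * s powr S"
        using moment_fun_pred[of s S] S s by auto
      moreover have "0 \<le> moment_fun s (max (S - 1) 0)" by (simp add: moment_fun_def)
      ultimately show ?case unfolding S_def[symmetric] using s elim
        by (simp add: ennreal_mult[symmetric] ennreal_plus[symmetric] ennreal_leI del: ennreal_plus)
    qed
    finally show ?thesis using s by (subst (asm) nn_integral_copies_weighted_sum[OF \<mu>]) (auto simp: mult_ac)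
  qed
  have "ennreal s * (\<integral>\<^sup>+x. ennreal (moment_fun s x) \<partial>next_law N \<mu>) + ?K = (\<integral>\<^sup>+k. ennreal s * ?I k + ?K \<partial>N)"
    by (subst nn_integral_add) (auto simp: nn_next[OF \<mu>] nn_integral_cmult emeasure_space_1)
  also have "\<dots> \<le> (\<integral>\<^sup>+k. ?D * (of_nat k * ?h ^ (k - 1)) \<partial>N)"
    by (intro nn_integral_mono_AE, use ge_1 in eventually_elim) (rule le)
  also have "\<dots> = ?D * (\<integral>\<^sup>+k. of_nat k * ?h ^ (k - 1) \<partial>N)"
    by (intro nn_integral_cmult) measurable
  finally show ?thesis .
qed

text \<open>With moment \<open>D\<close> and loss \<open>K\<close>, merging adds at most
  \<open>C * m * D * K\<close> to \<open>m * D\<close>. This is at most \<open>K\<close> once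
  \<open>C * m * D \<le> 1\<close>, so only the drift \<open>m / s\<close> remains.\<close>

lemma moment_next_le:
  "\<exists>\<delta>>0. \<forall>s \<mu>. nonneg_law \<mu> \<longrightarrow> 1 < s \<longrightarrow> s \<le> m \<longrightarrow> (\<integral>\<^sup>+x. ennreal (moment_fun s x) \<partial>\<mu>) \<le> ennreal \<delta> \<longrightarrow>
     (\<integral>\<^sup>+x. ennreal (moment_fun s x) \<partial>next_law N \<mu>) \<le> ennreal (m / s) * (\<integral>\<^sup>+x. ennreal (moment_fun s x) \<partial>\<mu>)"
proof -
  obtain C where C: "0 < C" "\<And>h. h \<in> {1..sqrt t} \<Longrightarrow> (\<integral>\<^sup>+k. ennreal (real k * h ^ (k - 1)) \<partial>N) \<le> ennreal (m + C * (h - 1))"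
    using size_biased_power_bound by auto
  have u: "1 < sqrt t" using t_gt_1 by simp
  \<comment> \<open>The first bound keeps \<open>1 + m * K\<close> inside the interval of
    \<open>size_biased_power_bound\<close>; the second makes the gain at most the loss.\<close>
  define \<delta> where "\<delta> = min ((sqrt t - 1) / m) (1 / (C * m))"
  have "\<delta> \<le> (sqrt t - 1) / m" "\<delta> \<le> 1 / (C * m)" by (simp_all add: \<delta>_def)
  then have \<delta>: "m * \<delta> \<le> sqrt t - 1" "C * m * \<delta> \<le> 1"
    using C(1) m_gt_1 by (auto simp: pos_le_divide_eq mult.commute)
  have "0 < \<delta>" using C(1) u m_gt_1 by (auto simp: \<delta>_def)
  note \<delta> = this \<delta>
  show ?thesis
  proof (intro exI[of _ \<delta>] conjI allI impI \<delta>(1))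
    fix s \<mu> assume \<mu>: "nonneg_law \<mu>" and s: "1 < s" "s \<le> m"
      and le: "(\<integral>\<^sup>+x. ennreal (moment_fun s x) \<partial>\<mu>) \<le> ennreal \<delta>"
    interpret X: prob_space \<mu> using \<mu> by (simp add: nonneg_law_def)
    have [measurable_cong]: "sets \<mu> = sets borel" and nn: "AE x in \<mu>. 0 \<le> x"
      using \<mu> by (simp_all add: nonneg_law_def)
    obtain D where D: "(\<integral>\<^sup>+x. ennreal (moment_fun s x) \<partial>\<mu>) = ennreal D" "0 \<le> D" "D \<le> \<delta>"
      using le \<delta>(1) by (cases "\<integral>\<^sup>+x. ennreal (moment_fun s x) \<partial>\<mu>") (auto simp: top_unique)
    have "(\<integral>\<^sup>+x. ennreal (min x 1 * s powr x) \<partial>\<mu>) \<le> ennreal D"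
      unfolding D(1)[symmetric]
      by (intro nn_integral_mono ennreal_leI) (auto simp: moment_fun_def intro!: mult_right_mono)
    then obtain K where K: "(\<integral>\<^sup>+x. ennreal (min x 1 * s powr x) \<partial>\<mu>) = ennreal K" "0 \<le> K" "K \<le> D"
      using D(2) by (cases "\<integral>\<^sup>+x. ennreal (min x 1 * s powr x) \<partial>\<mu>") (auto simp: top_unique)
    have "(\<integral>\<^sup>+x. ennreal (s powr x) \<partial>\<mu>) \<le> (\<integral>\<^sup>+x. 1 + ennreal m * ennreal (min x 1 * s powr x) \<partial>\<mu>)"
    proof (intro nn_integral_mono_AE, use nn in eventually_elim)
      case (elim x)
      have "ennreal (s powr x) \<le> ennreal (1 + m * (min x 1 * s powr x))"
        using powr_diff_one_le[OF s elim] by (intro ennreal_leI) auto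
      then show ?case using elim m_gt_1 by (simp add: ennreal_mult)
    qed
    also have "\<dots> = ennreal (1 + m * K)"
      using K m_gt_1 by (subst nn_integral_add) (auto simp: nn_integral_cmult X.emeasure_space_1 ennreal_mult)
    finally have h: "(\<integral>\<^sup>+x. ennreal (s powr x) \<partial>\<mu>) \<le> ennreal (1 + m * K)" .
    have "m * K \<le> m * \<delta>" using K D m_gt_1 by (intro mult_left_mono) auto
    moreover have "0 \<le> m * K" using K m_gt_1 by simp
    ultimately have hr: "1 + m * K \<in> {1..sqrt t}" using \<delta>(2) unfolding atLeastAtMost_iff by linarith
    have "(\<integral>\<^sup>+k. of_nat k * (\<integral>\<^sup>+x. ennreal (s powr x) \<partial>\<mu>) ^ (k - 1) \<partial>N)
        \<le> (\<integral>\<^sup>+k. ennreal (real k * (1 + m * K) ^ (k - 1)) \<partial>N)"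
    proof (intro nn_integral_mono)
      fix k :: nat
      have "of_nat k * (\<integral>\<^sup>+x. ennreal (s powr x) \<partial>\<mu>) ^ (k - 1) \<le> of_nat k * ennreal (1 + m * K) ^ (k - 1)"
        by (intro mult_left_mono power_mono h) auto
      also have "\<dots> = ennreal (real k * (1 + m * K) ^ (k - 1))"
        using hr by (simp add: ennreal_mult ennreal_power ennreal_of_nat_eq_real_of_nat del: ennreal_plus)
      finally show "of_nat k * (\<integral>\<^sup>+x. ennreal (s powr x) \<partial>\<mu>) ^ (k - 1) \<le> ennreal (real k * (1 + m * K) ^ (k - 1))" .
    qed
    also have "\<dots> \<le> ennreal (m + C * (m * K))" using C(2)[OF hr] by simp
    finally have Z: "(\<integral>\<^sup>+k. of_nat k * (\<integral>\<^sup>+x. ennreal (s powr x) \<partial>\<mu>) ^ (k - 1) \<partial>N) \<le> ennreal (m + C * (m * K))" .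
    have "ennreal s * (\<integral>\<^sup>+x. ennreal (moment_fun s x) \<partial>next_law N \<mu>) + ennreal K \<le> ennreal D * ennreal (m + C * (m * K))"
      using nn_moment_next_le[OF \<mu> s(1)] mult_left_mono[OF Z, of "ennreal D"] unfolding D K by (auto intro: order_trans)
    also have "\<dots> = ennreal (D * (m + C * (m * K)))" using D K C m_gt_1 by (simp add: ennreal_mult)
    also have "D * (m + C * (m * K)) \<le> m * D + K"
    proof -
      have "C * m * D \<le> C * m * \<delta>" using D C m_gt_1 by (intro mult_left_mono) auto
      then have "(C * m * D) * K \<le> 1 * K" using \<delta> K by (intro mult_right_mono) auto
      then show ?thesis by (simp add: algebra_simps)
    qed
    then have "ennreal (D * (m + C * (m * K))) \<le> ennreal (m * D) + ennreal K"
      using D K m_gt_1 by (simp flip: ennreal_plus add: ennreal_leI)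
    \<comment> \<open>Here the loss cancels the gain; cancelling is allowed because \<open>K\<close>
      is finite.\<close>
    finally have "ennreal s * (\<integral>\<^sup>+x. ennreal (moment_fun s x) \<partial>next_law N \<mu>) \<le> ennreal (m * D)"
      using ennreal_add_left_cancel_le[of "ennreal K"] by (simp add: add.commute)
    then have "ennreal (1 / s) * (ennreal s * (\<integral>\<^sup>+x. ennreal (moment_fun s x) \<partial>next_law N \<mu>)) \<le> ennreal (1 / s) * ennreal (m * D)"
      by (intro mult_left_mono) auto
    moreover have "ennreal (1 / s) * (ennreal s * y) = y" for y
      using s by (simp add: mult.assoc[symmetric] ennreal_mult[symmetric])
    ultimately show "(\<integral>\<^sup>+x. ennreal (moment_fun s x) \<partial>next_law N \<mu>) \<le> ennreal (m / s) * (\<integral>\<^sup>+x. ennreal (moment_fun s x) \<partial>\<mu>)"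
      unfolding D using s D m_gt_1 by (simp add: ennreal_mult[symmetric])
  qed
qed

end

section \<open>Large exponential moments grow\<close>

text \<open>
  Without the cap \<open>R\<close> the moment may become infinite after finitely many steps. The cap is put on the
  exponent only: a function \<open>x g(x)\<close> with \<open>g\<close> nondecreasing stays superadditive.
\<close>

definition capped_moment_fun :: "real \<Rightarrow> real \<Rightarrow> real \<Rightarrow> real" where
  "capped_moment_fun s R x = x * s powr min x R"

text \<open>The capped moment of \<open>max (x - 1) 0\<close>: what a summand contributes when it is
  alone.\<close>

definition shifted_moment_fun :: "real \<Rightarrow> real \<Rightarrow> real \<Rightarrow> real" where
  "shifted_moment_fun s R x = max (x - 1) 0 * s powr min (x - 1) R"

text \<open>The restriction to \<open>x \<le> r\<close>, here and in \<open>low_exp_fun\<close>,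
  serves to keep two merging values below the cap: if \<open>2 * r \<le> R + 1\<close>, then
  \<open>x + y - 1 \<le> R\<close>.\<close>

definition low_moment_fun :: "real \<Rightarrow> real \<Rightarrow> real \<Rightarrow> real" where
  "low_moment_fun s r x = (if x \<le> r then max (x - 1) 0 * s powr (x - 1) else 0)"

definition low_exp_fun :: "real \<Rightarrow> real \<Rightarrow> real \<Rightarrow> real" where
  "low_exp_fun s r x = (if x \<le> r then s powr x - 1 else 0)"

lemma capped_measurables [measurable]:
  "capped_moment_fun s R \<in> borel_measurable borel"
  "shifted_moment_fun s R \<in> borel_measurable borel"
  "low_moment_fun s r \<in> borel_measurable borel"
  "low_exp_fun s r \<in> borel_measurable borel"
  unfolding capped_moment_fun_def shifted_moment_fun_def low_moment_fun_def low_exp_fun_def by measurable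

lemma capped_nonneg:
  "0 \<le> x \<Longrightarrow> 0 \<le> capped_moment_fun s R x"
  "0 \<le> shifted_moment_fun s R x"
  "0 \<le> low_moment_fun s r x"
  "1 < s \<Longrightarrow> 0 \<le> x \<Longrightarrow> 0 \<le> low_exp_fun s r x"
  by (auto simp: capped_moment_fun_def shifted_moment_fun_def low_moment_fun_def low_exp_fun_def ge_one_powr_ge_zero)

text \<open>Every summand \<open>x i\<close> may be given the exponential factor \<open>G\<close> of
  the total. For summand 0 the presence of \<open>x 1\<close> improves its own factor by at least
  \<open>s powr x 1\<close>, which leaves the product term as a surplus; if one of the two values
  exceeds \<open>r\<close>, or \<open>x 0 \<le> 1\<close>, that product is 0.\<close>

lemma capped_moment_fun_superadditive:
  fixes x :: "nat \<Rightarrow> real"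
  assumes x: "\<And>i. 0 \<le> x i" and k: "1 \<le> k" and s: "1 < s" and r: "2 * r \<le> R + 1"
  shows "(\<Sum>i<k. shifted_moment_fun s R (x i)) + (if 2 \<le> k then low_moment_fun s r (x 0) * low_exp_fun s r (x 1) else 0)
    \<le> capped_moment_fun s R (max ((\<Sum>i<k. x i) - 1) 0)"
proof -
  define S where "S = (\<Sum>i<k. x i)"
  define G where "G = s powr min (S - 1) R"
  let ?ab = "low_moment_fun s r (x 0) * low_exp_fun s r (x 1)"
  have xS: "x i \<le> S" if "i < k" for i
    unfolding S_def using x that by (intro member_le_sum) auto
  have "(\<Sum>i<k. shifted_moment_fun s R (x i)) + (if 2 \<le> k then ?ab else 0)
      = (\<Sum>i<k. shifted_moment_fun s R (x i) + (if i = 0 \<and> 2 \<le> k then ?ab else 0))"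
    using k by (auto simp: sum.distrib)
  also have "\<dots> \<le> (\<Sum>i<k. max (x i - 1) 0 * G)"
  proof (intro sum_mono)
    fix i assume "i \<in> {..<k}"
    then have i: "i < k" by simp
    have G: "s powr min (x i - 1) R \<le> G"
      unfolding G_def using s xS[OF i] by (intro powr_mono) auto
    have 1: "shifted_moment_fun s R (x i) \<le> max (x i - 1) 0 * G"
      unfolding shifted_moment_fun_def by (intro mult_left_mono G) auto
    show "shifted_moment_fun s R (x i) + (if i = 0 \<and> 2 \<le> k then ?ab else 0) \<le> max (x i - 1) 0 * G"
    proof (cases "i = 0 \<and> 2 \<le> k \<and> x 0 \<le> r \<and> x 1 \<le> r \<and> 1 < x 0")
      case True
      have "x 0 + x 1 = (\<Sum>i<2. x i)" by (simp add: numeral_2_eq_2)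
      also have "\<dots> \<le> S" unfolding S_def using x True by (intro sum_mono2) auto
      finally have "s powr (x 0 - 1 + x 1) \<le> G"
        unfolding G_def using True r s by (intro powr_mono) auto
      then have "max (x 0 - 1) 0 * (s powr (x 0 - 1) * s powr x 1) \<le> max (x 0 - 1) 0 * G"
        using s by (intro mult_left_mono) (auto simp: powr_add)
      moreover have "min (x 0 - 1) R = x 0 - 1" using True r x[of 1] by auto
      ultimately show ?thesis using True
        by (simp add: shifted_moment_fun_def low_moment_fun_def low_exp_fun_def algebra_simps)
    next
      case False
      then have "i = 0 \<and> 2 \<le> k \<longrightarrow> ?ab = 0" by (auto simp: low_moment_fun_def low_exp_fun_def)
      then show ?thesis using 1 by auto
    qed
  qed
  also have "\<dots> = (\<Sum>i<k. max (x i - 1) 0) * G" by (simp add: sum_distrib_right)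
  also have "\<dots> \<le> max (S - 1) 0 * G"
    using excess_superadditive[of x k 1] x k unfolding S_def G_def by (intro mult_right_mono) auto
  also have "\<dots> = capped_moment_fun s R (max (S - 1) 0)"
    by (auto simp: capped_moment_fun_def G_def max_def)
  finally show ?thesis unfolding S_def .
qed

text \<open>The converse of \<open>powr_diff_one_le\<close>: the loss is bounded by the excess of
  \<open>s powr x\<close> over 1, the quantity that drives merging.\<close>

lemma min_powr_le:
  fixes s x :: real
  assumes "1 < s" "0 \<le> x"
  shows "min x 1 * s powr x * ln s \<le> s * (s powr x - 1)"
proof (cases "x \<le> 1")
  case True
  have "s powr x \<le> s powr 1" using assms True by (intro powr_mono) auto
  moreover have "x * ln s \<le> s powr x - 1"
  proof -
    have "s powr x = exp (x * ln s)" using assms by (simp add: powr_def)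
    with exp_ge_add_one_self[of "x * ln s"] show ?thesis by linarith
  qed
  ultimately have "s powr x * (x * ln s) \<le> s * (s powr x - 1)"
    using assms by (intro mult_mono) auto
  then show ?thesis using True by (simp add: algebra_simps)
next
  case False
  have "s powr 1 \<le> s powr x" using assms False by (intro powr_mono) auto
  then have "s powr x * (s - 1) \<le> s * (s powr x - 1)" using assms by (simp add: algebra_simps)
  moreover have "s powr x * ln s \<le> s powr x * (s - 1)"
    using assms ln_le_minus_one[of s] by (intro mult_left_mono) auto
  ultimately show ?thesis using False by simp
qed

text \<open>Splits the loss \<open>min x 1 * s powr min x R\<close>. For \<open>x \<le> r\<close> it
  is at most \<open>C\<close> times \<open>low_exp_fun\<close>; for \<open>x > r\<close> the
  inequality \<open>1 \<le> x / r\<close> makes it at most the fraction \<open>1 / r\<close> of the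
  capped moment.\<close>

lemma capped_moment_fun_le_shifted:
  assumes s: "1 < s" "s \<le> m" and C: "s \<le> C * ln s" and r: "1 \<le> r" "r \<le> R" and x: "0 \<le> x"
  shows "m / s * capped_moment_fun s R x
    \<le> m * shifted_moment_fun s R x + m / s * (C * low_exp_fun s r x + capped_moment_fun s R x / r)"
proof -
  have "s powr min x R \<le> s powr (min (x - 1) R + 1)" using s by (intro powr_mono) auto
  also have "\<dots> = s * s powr (min (x - 1) R)" using s by (simp add: powr_add)
  finally have "max (x - 1) 0 * s powr min x R \<le> max (x - 1) 0 * (s * s powr (min (x - 1) R))"
    by (intro mult_left_mono) auto
  then have 1: "m / s * (max (x - 1) 0 * s powr min x R) \<le> m * shifted_moment_fun s R x"
    using s by (simp add: shifted_moment_fun_def field_simps)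
  have 2: "min x 1 * s powr min x R \<le> C * low_exp_fun s r x + capped_moment_fun s R x / r"
  proof (cases "x \<le> r")
    case True
    have "min x 1 * s powr x * ln s \<le> s * (s powr x - 1)" using min_powr_le s x by auto
    also have "\<dots> \<le> C * ln s * (s powr x - 1)" using s x C by (intro mult_right_mono) (auto simp: ge_one_powr_ge_zero)
    finally have "min x 1 * s powr x * ln s \<le> C * (s powr x - 1) * ln s" by (simp add: mult_ac)
    then have "min x 1 * s powr x \<le> C * (s powr x - 1)" using s by simp
    moreover have "0 \<le> capped_moment_fun s R x / r" using r x capped_nonneg(1) by auto
    ultimately show ?thesis using True r by (simp add: low_exp_fun_def)
  next
    case False
    then have "1 * s powr min x R \<le> x / r * s powr min x R" using r by (intro mult_right_mono) auto
    then show ?thesis using False r by (simp add: low_exp_fun_def capped_moment_fun_def)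
  qed
  have "capped_moment_fun s R x = (max (x - 1) 0 + min x 1) * s powr min x R"
    using x by (simp add: capped_moment_fun_def max_def min_def)
  then have "m / s * capped_moment_fun s R x = m / s * (max (x - 1) 0 * s powr min x R) + m / s * (min x 1 * s powr min x R)"
    by (simp add: algebra_simps)
  also have "\<dots> \<le> m * shifted_moment_fun s R x + m / s * (C * low_exp_fun s r x + capped_moment_fun s R x / r)"
    using s by (intro add_mono 1 mult_left_mono 2) auto
  finally show ?thesis .
qed

text \<open>Values below 2 contribute at most \<open>2 * m\<^sup>2\<close>. Between 2 and
  \<open>r\<close> one has \<open>x \<le> 2 * (x - 1)\<close>, and one factor \<open>s\<close> is at
  most \<open>m\<close>, whence \<open>2 * m\<close>.\<close>

lemma capped_moment_fun_le_low:
  assumes s: "1 < s" "s \<le> m" and r: "r \<le> R" and x: "0 \<le> x"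
  shows "capped_moment_fun s R x \<le> 2 * m * low_moment_fun s r x + 2 * m\<^sup>2 + (if r < x then capped_moment_fun s R x else 0)"
proof (cases "r < x")
  case False
  show ?thesis
  proof (cases "x < 2")
    case True
    have "s powr min x R \<le> s powr 2" using s True by (intro powr_mono) auto
    also have "\<dots> \<le> m\<^sup>2" using s by (simp add: power_mono)
    finally have "x * s powr min x R \<le> 2 * m\<^sup>2" using x True by (intro mult_mono) auto
    moreover have "0 \<le> 2 * m * low_moment_fun s r x" using capped_nonneg(3) s by auto
    ultimately show ?thesis using False by (simp add: capped_moment_fun_def)
  next
    case x2: False
    have "s powr x = s * s powr (x - 1)" using s by (simp add: powr_diff)
    also have "\<dots> \<le> m * s powr (x - 1)" using s by (intro mult_right_mono) auto
    finally have "x * s powr x \<le> 2 * (x - 1) * (m * s powr (x - 1))" using x2 by (intro mult_mono) auto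
    moreover have "0 \<le> m\<^sup>2" by simp
    moreover have "2 * m * low_moment_fun s r x = 2 * (x - 1) * (m * s powr (x - 1))"
      using False x2 by (simp add: low_moment_fun_def)
    moreover have "capped_moment_fun s R x = x * s powr x" using False r by (simp add: capped_moment_fun_def)
    moreover have "0 \<le> m\<^sup>2" by simp
    ultimately have "capped_moment_fun s R x \<le> 2 * m * low_moment_fun s r x + 2 * m\<^sup>2" by linarith
    then show ?thesis using False by simp
  qed
next
  case True
  have "0 \<le> 2 * m * low_moment_fun s r x" using capped_nonneg(3) s by auto
  then show ?thesis using True by simp
qed

text \<open>Expresses the moment through the excesses \<open>max (x - real k) 0\<close>, whose
  integrals are bounded by future means via \<open>nn_expect_at_ge_excess\<close>. For each
  \<open>x\<close> one suitable term of the sum is enough.\<close>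

lemma capped_moment_fun_le_excess:
  assumes s: "1 < s" and K: "K < R" and x: "real K + 1 \<le> x"
  shows "capped_moment_fun s (real R) x \<le> (\<Sum>k\<in>{K..<R}. (real k + 2) * s ^ (k + 2) * max (x - real k) 0)"
proof -
  \<comment> \<open>One below the integer part, so that the excess \<open>x - real k\<close> is at
    least 1 while \<open>x \<le> real k + 2\<close>. Beyond the cap, \<open>k\<close> stays at
    \<open>R - 1\<close> and the linear factor of the excess takes over.\<close>
  define k where "k = min (R - 1) (nat \<lfloor>x\<rfloor> - 1)"
  have fl: "K + 1 \<le> nat \<lfloor>x\<rfloor>" using x by (simp add: le_nat_iff le_floor_iff)
  then have k: "k \<in> {K..<R}" unfolding k_def using K by auto
  have "x * s powr min x R \<le> (real k + 2) * s ^ (k + 2) * max (x - real k) 0"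
  proof (cases "x < R")
    case True
    then have "nat \<lfloor>x\<rfloor> \<le> R - 1 + 1" using x by linarith
    then have k': "real k = real (nat \<lfloor>x\<rfloor>) - 1" unfolding k_def using fl K by auto
    then have k1: "1 \<le> x - real k" "x \<le> real k + 2" using x fl by linarith+
    have "s powr min x R \<le> s powr (real k + 2)" using s k1 by (intro powr_mono) auto
    also have "\<dots> = s powr real (k + 2)" by (simp add: add.commute)
    also have "\<dots> = s ^ (k + 2)" using s by (intro powr_realpow) auto
    finally have "x * s powr min x R \<le> ((real k + 2) * s ^ (k + 2)) * 1"
      using x k1 s by (simp add: mult_mono)
    also have "\<dots> \<le> (real k + 2) * s ^ (k + 2) * max (x - real k) 0"
      using k1 s by (intro mult_left_mono) auto
    finally show ?thesis .
  next
    case False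
    then have "R \<le> nat \<lfloor>x\<rfloor>" by (simp add: le_nat_iff le_floor_iff)
    then have k': "real k = real R - 1" unfolding k_def using K by auto
    have "0 \<le> (real R - 1) * (x - real R)" using False K by (intro mult_nonneg_nonneg) auto
    moreover have "0 \<le> x - real R" using False by simp
    ultimately have "x \<le> (real k + 2) * max (x - real k) 0" using False unfolding k' by (simp add: algebra_simps)
    moreover have "s powr min x R \<le> s ^ (k + 2)"
    proof -
      have "s powr min x R \<le> s powr (real k + 2)" using s k' by (intro powr_mono) auto
      also have "\<dots> = s powr real (k + 2)" by (simp add: add.commute)
      also have "\<dots> = s ^ (k + 2)" using s by (intro powr_realpow) auto
      finally show ?thesis .
    qed
    ultimately have "x * s powr min x R \<le> ((real k + 2) * max (x - real k) 0) * s ^ (k + 2)"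
      using x s by (intro mult_mono) auto
    then show ?thesis by (simp add: mult_ac)
  qed
  also have "\<dots> \<le> (\<Sum>k\<in>{K..<R}. (real k + 2) * s ^ (k + 2) * max (x - real k) 0)"
    using k s by (intro member_le_sum[of k "{K..<R}" "\<lambda>k. (real k + 2) * s ^ (k + 2) * max (x - real k) 0"]) auto
  finally show ?thesis by (simp add: capped_moment_fun_def)
qed

section \<open>Growth of the capped moment\<close>

context offspring_law begin

definition branching_prob :: real where "branching_prob = prob {2..}"

lemma branching_prob_pos: "0 < branching_prob"
proof (rule ccontr)
  assume "\<not> 0 < branching_prob"
  then have "branching_prob = 0" unfolding branching_prob_def using measure_nonneg[of N "{2..}"] by linarith
  then have "emeasure N {2..} = 0" by (simp add: emeasure_eq_measure branching_prob_def)
  then have "AE k in N. k \<notin> {2..}" using sets_N by (intro AE_not_in) auto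
  with ge_1 have "AE k in N. real k = 1" by eventually_elim auto
  then have "(\<integral>k. real k \<partial>N) = (\<integral>k. 1 \<partial>N)" by (intro integral_cong_AE) auto
  then show False using mean m_gt_1 by (simp add: prob_space)
qed

text \<open>The surplus of \<open>capped_moment_fun_superadditive\<close> is present when there are
  at least two summands, and its integral factors by independence of summands 0 and 1.\<close>

lemma nn_capped_next_ge:
  assumes \<mu>: "nonneg_law \<mu>" and s: "1 < s" and r: "2 * r \<le> R + 1"
  shows "ennreal m * (\<integral>\<^sup>+x. ennreal (shifted_moment_fun s R x) \<partial>\<mu>)
      + ennreal branching_prob * ((\<integral>\<^sup>+x. ennreal (low_moment_fun s r x) \<partial>\<mu>) * (\<integral>\<^sup>+x. ennreal (low_exp_fun s r x) \<partial>\<mu>))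
    \<le> (\<integral>\<^sup>+x. ennreal (capped_moment_fun s R x) \<partial>next_law N \<mu>)"
    (is "_ * ?c + _ * (?A * ?B) \<le> _")
proof -
  have [measurable_cong]: "sets (copies \<mu>) = sets (copies borel)"
    using \<mu> by (intro sets_copies) (simp add: nonneg_law_def)
  interpret P: prob_space "copies \<mu>" by (rule prob_space_copies[OF \<mu>])
  define \<phi> where "\<phi> i y = ennreal (if i = 0 then low_moment_fun s r y else low_exp_fun s r y)" for i :: nat and y
  have [measurable]: "\<phi> i \<in> borel_measurable borel" for i unfolding \<phi>_def by measurable
  have AB: "(\<integral>\<^sup>+x. \<phi> 0 (x 0) * \<phi> 1 (x 1) \<partial>copies \<mu>) = ?A * ?B"
    using nn_integral_copies_prod[OF \<mu>, of \<phi> 2] by (simp add: numeral_2_eq_2 \<phi>_def)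
  have le: "of_nat k * ?c + indicator {2..} k * (?A * ?B)
      \<le> (\<integral>\<^sup>+x. ennreal (capped_moment_fun s R (max ((\<Sum>i<k. x i) - 1) 0)) \<partial>copies \<mu>)" if k: "1 \<le> k" for k :: nat
  proof -
    have "of_nat k * ?c + indicator {2..} k * (?A * ?B)
       = (\<integral>\<^sup>+x. (\<Sum>i<k. ennreal (shifted_moment_fun s R (x i))) + indicator {2..} k * (\<phi> 0 (x 0) * \<phi> 1 (x 1)) \<partial>copies \<mu>)"
      by (subst nn_integral_add) (auto simp: nn_integral_cmult AB[unfolded One_nat_def] nn_integral_copies_sum[OF \<mu>, of "\<lambda>y. ennreal (shifted_moment_fun s R y)"])
    also have "\<dots> \<le> (\<integral>\<^sup>+x. ennreal (capped_moment_fun s R (max ((\<Sum>i<k. x i) - 1) 0)) \<partial>copies \<mu>)"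
    proof (intro nn_integral_mono_AE, use AE_copies_nonneg[OF \<mu>] in eventually_elim)
      case (elim x)
      have "(\<Sum>i<k. ennreal (shifted_moment_fun s R (x i))) + indicator {2..} k * (\<phi> 0 (x 0) * \<phi> 1 (x 1))
        = ennreal ((\<Sum>i<k. shifted_moment_fun s R (x i)) + (if 2 \<le> k then low_moment_fun s r (x 0) * low_exp_fun s r (x 1) else 0))"
        using elim s by (subst ennreal_plus)
          (auto simp: \<phi>_def ennreal_mult capped_nonneg intro!: sum_nonneg split: split_indicator)
      also have "\<dots> \<le> ennreal (capped_moment_fun s R (max ((\<Sum>i<k. x i) - 1) 0))"
        using elim k s r by (intro ennreal_leI capped_moment_fun_superadditive) auto
      finally show ?case .
    qed
    finally show ?thesis .
  qed
  have "ennreal m * ?c + ennreal branching_prob * (?A * ?B) = (\<integral>\<^sup>+k. of_nat k * ?c + indicator {2..} k * (?A * ?B) \<partial>N)"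
    by (subst nn_integral_add) (auto simp: nn_integral_multc nn_mean branching_prob_def emeasure_eq_measure)
  also have "\<dots> \<le> (\<integral>\<^sup>+x. ennreal (capped_moment_fun s R x) \<partial>next_law N \<mu>)"
    unfolding nn_next[OF \<mu>, of "\<lambda>x. ennreal (capped_moment_fun s R x)", simplified]
    by (intro nn_integral_mono_AE, use ge_1 in eventually_elim) (rule le)
  finally show ?thesis .
qed

text \<open>Above this value the creation of large values by merging outweighs the loss at \<open>0\<close>.\<close>

definition growth_threshold :: real where
  "growth_threshold = 2 * m\<^sup>2 + 1 + 2 * m * (3 * (2 * m / ln m) / branching_prob)"

lemma growth_threshold_ge_1: "1 \<le> growth_threshold"
  unfolding growth_threshold_def using m_gt_1 branching_prob_pos by auto

text \<open>Both the loss from values up to \<open>r\<close> and the merging gain are proportional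
  to \<open>B\<close>, the integral of \<open>low_exp_fun\<close>. Comparing their coefficients
  therefore suffices, however small \<open>B\<close> is. What is left is the loss from values above
  \<open>r\<close>, a fraction \<open>1 / r\<close> of the moment.\<close>

lemma capped_moment_growth:
  assumes \<mu>: "nonneg_law \<mu>" and s: "1 < s" "s \<le> m" "m \<le> s\<^sup>2" "m / s \<le> 3" and r: "1 \<le> r" "2 * r = R"
    and D: "(\<integral>\<^sup>+x. ennreal (capped_moment_fun s R x) \<partial>\<mu>) = ennreal D" "growth_threshold \<le> D"
    and rest: "(\<integral>\<^sup>+x. ennreal (if r < x then capped_moment_fun s R x else 0) \<partial>\<mu>) \<le> 1"
  shows "ennreal (m / s * (1 - 1 / r) * D) \<le> (\<integral>\<^sup>+x. ennreal (capped_moment_fun s R x) \<partial>next_law N \<mu>)"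
proof -
  interpret X: prob_space \<mu> using \<mu> by (simp add: nonneg_law_def)
  have [measurable_cong]: "sets \<mu> = sets borel" and nn: "AE x in \<mu>. 0 \<le> x"
    using \<mu> by (simp_all add: nonneg_law_def)
  \<comment> \<open>A constant for \<open>capped_moment_fun_le_shifted\<close> that is uniform in
    \<open>s\<close>, because \<open>m \<le> s\<^sup>2\<close> gives
    \<open>ln m \<le> 2 * ln s\<close>.\<close>
  define C where "C = 2 * m / ln m"
  have lnm: "0 < ln m" "ln m \<le> 2 * ln s"
  proof -
    have "ln m \<le> ln (s\<^sup>2)" using s m_gt_1 by simp
    also have "\<dots> = 2 * ln s" using s by (simp add: ln_realpow)
    finally show "ln m \<le> 2 * ln s" .
  qed (use m_gt_1 in auto)
  have C: "0 < C" "s \<le> C * ln s"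
  proof -
    have "s * ln m \<le> m * (2 * ln s)" using s lnm by (intro mult_mono) auto
    then show "s \<le> C * ln s" unfolding C_def using lnm by (simp add: field_simps)
  qed (use lnm m_gt_1 in \<open>auto simp: C_def\<close>)
  have D0: "0 \<le> D" using D growth_threshold_ge_1 by linarith
  \<comment> \<open>Integrals dominated by the capped moment are finite, so the following
    inequalities can be moved to the reals, where terms may be subtracted.\<close>
  have fin: "\<exists>c\<ge>0. (\<integral>\<^sup>+x. ennreal (f x) \<partial>\<mu>) = ennreal c" if "\<And>x. 0 \<le> x \<Longrightarrow> f x \<le> capped_moment_fun s R x" for f
  proof -
    have "(\<integral>\<^sup>+x. ennreal (f x) \<partial>\<mu>) \<le> ennreal D"
      unfolding D(1)[symmetric] using that nn by (intro nn_integral_mono_AE) (auto elim!: eventually_mono intro: ennreal_leI)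
    then show ?thesis by (cases "\<integral>\<^sup>+x. ennreal (f x) \<partial>\<mu>") (auto simp: top_unique)
  qed
  have "\<exists>c\<ge>0. (\<integral>\<^sup>+x. ennreal (shifted_moment_fun s R x) \<partial>\<mu>) = ennreal c"
    using s by (intro fin) (auto simp: shifted_moment_fun_def capped_moment_fun_def intro!: mult_mono powr_mono)
  then obtain c where c: "0 \<le> c" "(\<integral>\<^sup>+x. ennreal (shifted_moment_fun s R x) \<partial>\<mu>) = ennreal c" by blast
  have "\<exists>A\<ge>0. (\<integral>\<^sup>+x. ennreal (low_moment_fun s r x) \<partial>\<mu>) = ennreal A"
    using s r by (intro fin) (auto simp: low_moment_fun_def capped_moment_fun_def intro!: mult_mono powr_mono)
  then obtain A where A: "0 \<le> A" "(\<integral>\<^sup>+x. ennreal (low_moment_fun s r x) \<partial>\<mu>) = ennreal A" by blast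
  have "(\<integral>\<^sup>+x. ennreal (low_exp_fun s r x) \<partial>\<mu>) \<le> (\<integral>\<^sup>+x. ennreal (s powr r) \<partial>\<mu>)"
  proof (intro nn_integral_mono ennreal_leI)
    fix x :: real
    show "low_exp_fun s r x \<le> s powr r"
    proof (cases "x \<le> r")
      case True
      then have "s powr x \<le> s powr r" using s by (intro powr_mono) auto
      then show ?thesis using True by (simp add: low_exp_fun_def)
    qed (simp add: low_exp_fun_def)
  qed
  also have "\<dots> = ennreal (s powr r)" by (simp add: X.emeasure_space_1)
  finally obtain B where B: "0 \<le> B" "(\<integral>\<^sup>+x. ennreal (low_exp_fun s r x) \<partial>\<mu>) = ennreal B"
    by (cases "\<integral>\<^sup>+x. ennreal (low_exp_fun s r x) \<partial>\<mu>") (auto simp: top_unique)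
  have ms: "0 < m / s" using s by simp
  have "ennreal (m / s * D) = (\<integral>\<^sup>+x. ennreal (m / s) * ennreal (capped_moment_fun s R x) \<partial>\<mu>)"
    using D0 ms by (simp add: nn_integral_cmult D(1) ennreal_mult[symmetric])
  also have "\<dots> \<le> (\<integral>\<^sup>+x. ennreal m * ennreal (shifted_moment_fun s R x)
       + (ennreal (m / s * C) * ennreal (low_exp_fun s r x) + ennreal (m / s / r) * ennreal (capped_moment_fun s R x)) \<partial>\<mu>)"
  proof (intro nn_integral_mono_AE, use nn in eventually_elim)
    case (elim x)
    have "m / s * capped_moment_fun s R x
      \<le> m * shifted_moment_fun s R x + (m / s * C * low_exp_fun s r x + m / s / r * capped_moment_fun s R x)"
      using capped_moment_fun_le_shifted[OF s(1,2) C(2) r(1) _ elim, of R] r by (simp add: algebra_simps)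
    then have "ennreal (m / s * capped_moment_fun s R x)
      \<le> ennreal (m * shifted_moment_fun s R x + (m / s * C * low_exp_fun s r x + m / s / r * capped_moment_fun s R x))"
      by (rule ennreal_leI)
    moreover have "0 \<le> m * shifted_moment_fun s R x" "0 \<le> m / s * C * low_exp_fun s r x" "0 \<le> m / s / r * capped_moment_fun s R x"
      using ms C r elim s capped_nonneg m_gt_1 by (auto intro!: mult_nonneg_nonneg)
    ultimately show ?case using ms C r elim s capped_nonneg m_gt_1 by (simp add: ennreal_mult[symmetric])
  qed
  also have "\<dots> = ennreal m * ennreal c + (ennreal (m / s * C) * ennreal B + ennreal (m / s / r) * ennreal D)"
    by (simp add: nn_integral_add nn_integral_cmult c A B D)
  also have "\<dots> = ennreal (m * c + (m / s * C * B + m / s / r * D))"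
    using s ms C r m_gt_1 c B D0 by (simp add: ennreal_mult[symmetric])
  finally have I: "m / s * D \<le> m * c + (m / s * C * B + m / s / r * D)"
    using s ms C r m_gt_1 c B D0 by (subst (asm) ennreal_le_iff) (auto intro!: add_nonneg_nonneg)
  have "ennreal D \<le> (\<integral>\<^sup>+x. ennreal (2 * m) * ennreal (low_moment_fun s r x)
      + (ennreal (2 * m\<^sup>2) + ennreal (if r < x then capped_moment_fun s R x else 0)) \<partial>\<mu>)"
    unfolding D(1)[symmetric]
  proof (intro nn_integral_mono_AE, use nn in eventually_elim)
    case (elim x)
    have "ennreal (capped_moment_fun s R x)
      \<le> ennreal (2 * m * low_moment_fun s r x + (2 * m\<^sup>2 + (if r < x then capped_moment_fun s R x else 0)))"
      using capped_moment_fun_le_low[OF s(1,2) _ elim, of r R] r by (intro ennreal_leI) auto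
    then show ?case using elim m_gt_1 s capped_nonneg
      by (subst ennreal_mult[symmetric]) (auto split: if_splits)
  qed
  also have "\<dots> = ennreal (2 * m) * ennreal A + (ennreal (2 * m\<^sup>2) + (\<integral>\<^sup>+x. ennreal (if r < x then capped_moment_fun s R x else 0) \<partial>\<mu>))"
    by (simp add: nn_integral_add nn_integral_cmult A X.emeasure_space_1)
  also have "\<dots> \<le> ennreal (2 * m) * ennreal A + (ennreal (2 * m\<^sup>2) + 1)"
    by (intro add_left_mono rest)
  also have "\<dots> = ennreal (2 * m * A + (2 * m\<^sup>2 + 1))"
    using A m_gt_1 by (simp add: ennreal_mult[symmetric] ennreal_plus[symmetric] ennreal_1[symmetric] del: ennreal_plus ennreal_1)
  finally have "D \<le> 2 * m * A + (2 * m\<^sup>2 + 1)"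
    using A m_gt_1 by (subst (asm) ennreal_le_iff) (auto intro!: add_nonneg_nonneg)
  \<comment> \<open>Since \<open>D\<close> is above the threshold, the low part \<open>A\<close> is
    so large that the gain \<open>branching_prob * A * B\<close> covers the loss
    \<open>m / s * C * B\<close>.\<close>
  then have "2 * m * (3 * C / branching_prob) \<le> 2 * m * A" using D(2) by (simp add: growth_threshold_def C_def)
  then have "3 * C \<le> branching_prob * A" using m_gt_1 branching_prob_pos by (simp add: field_simps)
  moreover have "m / s * C \<le> 3 * C" using s C by (intro mult_right_mono) auto
  ultimately have "m / s * C * B \<le> branching_prob * A * B" using B by (intro mult_right_mono) auto
  then have "m / s * (1 - 1 / r) * D \<le> m * c + branching_prob * A * B" using I by (simp add: algebra_simps)
  then have "ennreal (m / s * (1 - 1 / r) * D) \<le> ennreal (m * c + branching_prob * A * B)" by (rule ennreal_leI)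
  also have "\<dots> = ennreal m * ennreal c + ennreal branching_prob * (ennreal A * ennreal B)"
    using m_gt_1 branching_prob_pos A B c by (simp add: ennreal_mult mult.assoc)
  also have "\<dots> \<le> (\<integral>\<^sup>+x. ennreal (capped_moment_fun s R x) \<partial>next_law N \<mu>)"
    using nn_capped_next_ge[OF \<mu> s(1), of r R] r unfolding A B c by simp
  finally show ?thesis .
qed

text \<open>By hypothesis the excess over \<open>k\<close> has integral at most
  \<open>a / m ^ k\<close>, so the \<open>k\<close>-th term of
  \<open>capped_moment_fun_le_excess\<close> is of order \<open>(s / m) ^ k\<close>. There are at
  most \<open>R\<close> terms, with linear factors at most \<open>R + 1\<close>.\<close>

lemma capped_moment_tail_bound:
  assumes \<mu>: "nonneg_law \<mu>" and s: "1 < s" "s \<le> m" and K: "K < R" and a: "0 \<le> a"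
    and tail: "\<And>k. k < R \<Longrightarrow> ennreal (m ^ k) * (\<integral>\<^sup>+x. ennreal (x - real k) \<partial>\<mu>) \<le> ennreal a"
  shows "(\<integral>\<^sup>+x. ennreal (if real K + 1 \<le> x then capped_moment_fun s (real R) x else 0) \<partial>\<mu>)
    \<le> ennreal (a * m\<^sup>2 * (real R + 1)\<^sup>2 * (s / m) ^ K)"
proof -
  have [measurable_cong]: "sets \<mu> = sets borel" using \<mu> by (simp_all add: nonneg_law_def)
  have "(\<integral>\<^sup>+x. ennreal (if real K + 1 \<le> x then capped_moment_fun s (real R) x else 0) \<partial>\<mu>)
     \<le> (\<integral>\<^sup>+x. (\<Sum>k\<in>{K..<R}. ennreal ((real k + 2) * s ^ (k + 2)) * ennreal (x - real k)) \<partial>\<mu>)"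
  proof (intro nn_integral_mono)
    fix x :: real
    show "ennreal (if real K + 1 \<le> x then capped_moment_fun s (real R) x else 0)
      \<le> (\<Sum>k\<in>{K..<R}. ennreal ((real k + 2) * s ^ (k + 2)) * ennreal (x - real k))"
    proof (cases "real K + 1 \<le> x")
      case True
      have "ennreal (capped_moment_fun s (real R) x) \<le> ennreal (\<Sum>k\<in>{K..<R}. (real k + 2) * s ^ (k + 2) * max (x - real k) 0)"
        by (intro ennreal_leI capped_moment_fun_le_excess s K True)
      also have "\<dots> = (\<Sum>k\<in>{K..<R}. ennreal ((real k + 2) * s ^ (k + 2) * max (x - real k) 0))"
        using s by (intro sum_ennreal[symmetric]) auto
      also have "\<dots> = (\<Sum>k\<in>{K..<R}. ennreal ((real k + 2) * s ^ (k + 2)) * ennreal (x - real k))"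
        using s by (intro sum.cong refl, subst ennreal_mult) (auto simp: max_def ennreal_neg)
      finally show ?thesis using True by simp
    qed simp
  qed
  also have "\<dots> = (\<Sum>k\<in>{K..<R}. ennreal ((real k + 2) * s ^ (k + 2)) * (\<integral>\<^sup>+x. ennreal (x - real k) \<partial>\<mu>))"
    by (simp add: nn_integral_sum nn_integral_cmult)
  also have "\<dots> \<le> (\<Sum>k\<in>{K..<R}. ennreal (a * m\<^sup>2 * (real R + 1) * (s / m) ^ K))"
  proof (intro sum_mono)
    fix k assume k: "k \<in> {K..<R}"
    have mk: "ennreal (1 / m ^ k) * (ennreal (m ^ k) * y) = y" for y
      using m_gt_1 by (simp add: mult.assoc[symmetric] ennreal_mult[symmetric])
    have "(\<integral>\<^sup>+x. ennreal (x - real k) \<partial>\<mu>) \<le> ennreal (1 / m ^ k) * ennreal a"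
      using mult_left_mono[OF tail[of k], of "ennreal (1 / m ^ k)"] k mk by simp
    then have "ennreal ((real k + 2) * s ^ (k + 2)) * (\<integral>\<^sup>+x. ennreal (x - real k) \<partial>\<mu>)
      \<le> ennreal ((real k + 2) * s ^ (k + 2)) * (ennreal (1 / m ^ k) * ennreal a)"
      by (intro mult_left_mono) auto
    also have "\<dots> = ennreal ((real k + 2) * s ^ (k + 2) * (1 / m ^ k * a))"
      using s m_gt_1 a by (subst ennreal_mult[symmetric], simp_all) (subst ennreal_mult[symmetric], simp_all)
    also have "\<dots> \<le> ennreal (a * m\<^sup>2 * (real R + 1) * (s / m) ^ K)"
    proof (intro ennreal_leI)
      have "(real k + 2) * s ^ (k + 2) * (1 / m ^ k * a) = a * s\<^sup>2 * (real k + 2) * (s / m) ^ k"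
        by (simp add: power_add power_divide power2_eq_square)
      also have "\<dots> \<le> a * m\<^sup>2 * (real R + 1) * (s / m) ^ K"
        using a s k m_gt_1 by (intro mult_mono power_mono power_decreasing) auto
      finally show "(real k + 2) * s ^ (k + 2) * (1 / m ^ k * a) \<le> a * m\<^sup>2 * (real R + 1) * (s / m) ^ K" .
    qed
    finally show "ennreal ((real k + 2) * s ^ (k + 2)) * (\<integral>\<^sup>+x. ennreal (x - real k) \<partial>\<mu>) \<le> ennreal (a * m\<^sup>2 * (real R + 1) * (s / m) ^ K)" .
  qed
  also have "\<dots> = ennreal (real (R - K) * (a * m\<^sup>2 * (real R + 1) * (s / m) ^ K))"
    by (simp add: ennreal_mult' ennreal_of_nat_eq_real_of_nat)
  also have "\<dots> \<le> ennreal (a * m\<^sup>2 * (real R + 1)\<^sup>2 * (s / m) ^ K)"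
  proof (intro ennreal_leI)
    have "real (R - K) * (a * m\<^sup>2 * (real R + 1) * (s / m) ^ K) \<le> (real R + 1) * (a * m\<^sup>2 * (real R + 1) * (s / m) ^ K)"
      using a s m_gt_1 by (intro mult_right_mono) auto
    then show "real (R - K) * (a * m\<^sup>2 * (real R + 1) * (s / m) ^ K) \<le> a * m\<^sup>2 * (real R + 1)\<^sup>2 * (s / m) ^ K"
      by (simp add: power2_eq_square mult_ac)
  qed
  finally show ?thesis .
qed


text \<open>The growth runs for \<open>L * j\<close> steps with cutoff \<open>r = L * j\<close> and
  cap \<open>R = 2 * r\<close>; tail bounds look up to \<open>R\<close> further steps ahead, which
  gives the horizon \<open>3 * (L * j)\<close>. Condition \<open>c1\<close> makes values beyond the
  cutoff contribute at most 1, and \<open>c2\<close> makes the growth exceed the a priori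
  bound.\<close>

lemma expectation_exceeds:
  fixes L j :: nat
  assumes \<mu>: "nonneg_law \<mu>" and L: "2 \<le> real L * ln m" and j: "4 \<le> j" and a: "0 \<le> a"
    and c1: "a * m\<^sup>2 * (2 * real L * real j + 1)\<^sup>2 * exp (- (real L * real j - 1) / real L) \<le> 1"
    and c2: "m + a * m\<^sup>2 * (2 * real L * real j + 1)\<^sup>2 < (3 / 2) ^ j"
    and start: "ennreal growth_threshold \<le> (\<integral>\<^sup>+x. ennreal (capped_moment_fun (m * exp (- 1 / real L)) (2 * real L * real j) x) \<partial>\<mu>)"
  shows "\<exists>n\<le>3 * (L * j). ennreal a < nn_expect (law_at N \<mu> n)"
proof (rule ccontr)
  assume "\<not> ?thesis"
  then have H: "nn_expect (law_at N \<mu> n) \<le> ennreal a" if "n \<le> 3 * (L * j)" for n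
    using that by (auto simp: not_less)
  define s where "s = m * exp (- 1 / real L)"
  define R where "R = 2 * (L * j)"
  have L1: "1 \<le> L" using L by (cases L) auto
  have s2: "m \<le> s\<^sup>2"
  proof -
    have "2 / real L \<le> ln m" using L L1 by (simp add: field_simps)
    then have "exp (2 / real L) \<le> m" using m_gt_1 by (subst ln_ge_iff[symmetric]) auto
    then have "exp (2 / real L) * (exp (- 1 / real L))\<^sup>2 \<le> m * (exp (- 1 / real L))\<^sup>2"
      by (intro mult_right_mono) auto
    moreover have "exp (2 / real L) * (exp (- 1 / real L))\<^sup>2 = 1"
      by (simp add: power2_eq_square flip: exp_add)
    ultimately have "1 \<le> m * (exp (- 1 / real L))\<^sup>2" by linarith
    from mult_left_mono[OF this, of m] m_gt_1 show ?thesis by (simp add: s_def power2_eq_square mult_ac)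
  qed
  have s0: "0 < s" using m_gt_1 by (simp add: s_def)
  have s1: "1 < s" using s2 m_gt_1 s0 by (intro power_less_imp_less_base[of 1 2 s]) auto
  have sm: "s \<le> m" using m_gt_1 by (simp add: s_def)
  have ms: "m / s = exp (1 / real L)" using m_gt_1 by (simp add: s_def exp_minus field_simps)
  have "exp (1 / real L) \<le> exp 1" using L1 by simp
  then have ms3: "m / s \<le> 3" using ms exp_le by linarith
  have R: "2 * real L * real j = real R" "0 < R" using L1 j by (auto simp: R_def)
  \<comment> \<open>This is where bounded means are used: the times \<open>n + k\<close> stay within
    the horizon.\<close>
  have tail: "ennreal (m ^ k) * (\<integral>\<^sup>+x. ennreal (x - real k) \<partial>law_at N \<mu> n) \<le> ennreal a"
    if "n \<le> L * j" "k < R" for n k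
    using nn_expect_at_ge_excess[OF \<mu>, of k n] H[of "n + k"] that by (auto simp: R_def)
  let ?D = "\<lambda>n. \<integral>\<^sup>+x. ennreal (capped_moment_fun s (real R) x) \<partial>law_at N \<mu> n"
  have upper: "?D n \<le> ennreal (m + a * m\<^sup>2 * (real R + 1)\<^sup>2)" if n: "n \<le> L * j" for n
  proof -
    interpret X: prob_space "law_at N \<mu> n" using nonneg_at[OF \<mu>, of n] by (simp add: nonneg_law_def)
    have [measurable_cong]: "sets (law_at N \<mu> n) = sets borel" and nn: "AE x in law_at N \<mu> n. 0 \<le> x"
      using nonneg_at[OF \<mu>, of n] by (simp_all add: nonneg_law_def)
    have "?D n \<le> (\<integral>\<^sup>+x. ennreal m + ennreal (if real 0 + 1 \<le> x then capped_moment_fun s (real R) x else 0) \<partial>law_at N \<mu> n)"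
    proof (intro nn_integral_mono_AE, use nn in eventually_elim)
      case (elim x)
      show ?case
      proof (cases "1 \<le> x")
        case False
        have "s powr min x R \<le> s powr 1" using s1 False by (intro powr_mono) auto
        then have "x * s powr min x R \<le> 1 * m" using elim False s1 sm by (intro mult_mono) auto
        then show ?thesis using False by (simp add: capped_moment_fun_def ennreal_leI)
      qed (use m_gt_1 in simp)
    qed
    also have "\<dots> = ennreal m + (\<integral>\<^sup>+x. ennreal (if real 0 + 1 \<le> x then capped_moment_fun s (real R) x else 0) \<partial>law_at N \<mu> n)"
      by (subst nn_integral_add) (auto simp: X.emeasure_space_1)
    also have "\<dots> \<le> ennreal m + ennreal (a * m\<^sup>2 * (real R + 1)\<^sup>2 * (s / m) ^ 0)"
      using tail n by (intro add_left_mono capped_moment_tail_bound[OF nonneg_at[OF \<mu>] s1 sm R(2) a]) auto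
    also have "\<dots> = ennreal (m + a * m\<^sup>2 * (real R + 1)\<^sup>2)" using m_gt_1 a by simp
    finally show ?thesis .
  qed
  have rest: "(\<integral>\<^sup>+x. ennreal (if real (L * j) < x then capped_moment_fun s (real R) x else 0) \<partial>law_at N \<mu> n) \<le> 1"
    if n: "n \<le> L * j" for n
  proof -
    have nn: "AE x in law_at N \<mu> n. 0 \<le> x" using nonneg_at[OF \<mu>, of n] by (simp_all add: nonneg_law_def)
    have Lj: "1 \<le> L * j" using L1 j by simp
    \<comment> \<open>The tail bound covers values from \<open>K + 1\<close> on, so \<open>K\<close>
      is taken one below the cutoff.\<close>
    then have K: "L * j - 1 < R" unfolding R_def by linarith
    have K': "real (L * j - 1) = real L * real j - 1"
      using of_nat_diff[OF Lj, where 'a = real] by simp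
    have "(\<integral>\<^sup>+x. ennreal (if real (L * j) < x then capped_moment_fun s (real R) x else 0) \<partial>law_at N \<mu> n)
       \<le> (\<integral>\<^sup>+x. ennreal (if real (L * j - 1) + 1 \<le> x then capped_moment_fun s (real R) x else 0) \<partial>law_at N \<mu> n)"
      using nn K' by (intro nn_integral_mono_AE) (auto elim!: eventually_mono)
    also have "\<dots> \<le> ennreal (a * m\<^sup>2 * (real R + 1)\<^sup>2 * (s / m) ^ (L * j - 1))"
      using tail n by (intro capped_moment_tail_bound[OF nonneg_at[OF \<mu>] s1 sm K a]) auto
    also have "(s / m) ^ (L * j - 1) = exp (- (real L * real j - 1) / real L)"
    proof -
      have "(s / m) ^ (L * j - 1) = exp (real (L * j - 1) * (- 1 / real L))"
        using m_gt_1 by (simp add: s_def flip: exp_of_nat_mult)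
      also have "real (L * j - 1) * (- 1 / real L) = - (real L * real j - 1) / real L"
        unfolding K' by (metis mult.right_neutral mult_minus_right times_divide_eq_right)
      finally show ?thesis .
    qed
    also have "ennreal (a * m\<^sup>2 * (real R + 1)\<^sup>2 * exp (- (real L * real j - 1) / real L)) \<le> 1"
      using c1 unfolding R by (simp add: ennreal_le_1)
    finally show ?thesis .
  qed
  have grow: "ennreal ((1 + 1 / (2 * real L)) ^ n * growth_threshold) \<le> ?D n" if "n \<le> L * j" for n
    using that
  proof (induction n)
    case 0
    then show ?case using start by (simp add: s_def R(1))
  next
    case (Suc n)
    then have IH: "ennreal ((1 + 1 / (2 * real L)) ^ n * growth_threshold) \<le> ?D n" by simp
    obtain D where D: "?D n = ennreal D" "0 \<le> D"
      using upper[of n] Suc by (cases "?D n") (auto simp: top_unique)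
    have D': "(1 + 1 / (2 * real L)) ^ n * growth_threshold \<le> D"
      using IH D by (simp add: D(1))
    have "1 * growth_threshold \<le> (1 + 1 / (2 * real L)) ^ n * growth_threshold"
      using growth_threshold_ge_1 by (intro mult_right_mono one_le_power) auto
    then have gD: "growth_threshold \<le> D" using D' by linarith
    \<comment> \<open>The drift contributes \<open>1 / L\<close>, and \<open>4 \<le> j\<close>
      limits the relative loss \<open>1 / (L * j)\<close> to a quarter of it; at least half of the
      drift survives.\<close>
    have "1 + 1 / (2 * real L) \<le> (1 + 1 / real L) * (1 - 1 / (4 * real L))"
      using L1 by (simp add: field_simps)
    also have "\<dots> \<le> exp (1 / real L) * (1 - 1 / real (L * j))"
    proof (intro mult_mono)
      show "1 - 1 / (4 * real L) \<le> 1 - 1 / real (L * j)" using L1 j by (simp add: field_simps)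
      show "1 + 1 / real L \<le> exp (1 / real L)" by (rule exp_ge_add_one_self)
    qed (use L1 in \<open>auto simp: field_simps\<close>)
    finally have "(1 + 1 / (2 * real L)) * ((1 + 1 / (2 * real L)) ^ n * growth_threshold) \<le> m / s * (1 - 1 / real (L * j)) * D"
      unfolding ms using D D' growth_threshold_ge_1 by (intro mult_mono) (auto intro: order_trans[of 0 "1 + 1 / (2 * real L)"])
    then have "ennreal ((1 + 1 / (2 * real L)) ^ Suc n * growth_threshold) \<le> ennreal (m / s * (1 - 1 / real (L * j)) * D)"
      by (intro ennreal_leI) (simp add: mult.assoc)
    also have "\<dots> \<le> ?D (Suc n)"
      unfolding law_at.simps using mult_mono[of 1 "real L" 1 "real j"] L1 j Suc.prems R
      by (intro capped_moment_growth[OF nonneg_at[OF \<mu>] s1 sm s2 ms3 _ _ D(1) gD rest]) (auto simp: R_def)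
    finally show ?case .
  qed
  have "ennreal ((1 + 1 / (2 * real L)) ^ (L * j) * growth_threshold) \<le> ennreal (m + a * m\<^sup>2 * (real R + 1)\<^sup>2)"
    using grow[of "L * j"] upper[of "L * j"] by auto
  then have "(1 + 1 / (2 * real L)) ^ (L * j) * growth_threshold \<le> m + a * m\<^sup>2 * (real R + 1)\<^sup>2"
    using m_gt_1 a by (subst (asm) ennreal_le_iff) auto
  moreover have "(3 / 2) ^ j \<le> (1 + 1 / (2 * real L)) ^ (L * j)"
  proof -
    \<comment> \<open>By Bernoulli, each block of \<open>L\<close> steps gains at least the factor
      3/2.\<close>
    have "3 / 2 \<le> (1 + 1 / (2 * real L)) ^ L"
      using Bernoulli_inequality[of "1 / (2 * real L)" L] L1 by (auto simp: field_simps)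
    then have "(3 / 2) ^ j \<le> ((1 + 1 / (2 * real L)) ^ L) ^ j" by (intro power_mono) auto
    then show ?thesis by (simp add: power_mult)
  qed
  moreover have "(1 + 1 / (2 * real L)) ^ (L * j) * 1 \<le> (1 + 1 / (2 * real L)) ^ (L * j) * growth_threshold"
    using growth_threshold_ge_1 by (intro mult_left_mono) auto
  ultimately show False using c2 unfolding R by linarith
qed

section \<open>Bounds for the free energy\<close>

definition normalized_mean :: "real measure \<Rightarrow> nat \<Rightarrow> real" where
  "normalized_mean \<mu> n = (\<integral>x. x \<partial>law_at N \<mu> n) / m ^ n"

text \<open>Finiteness of the mean passes along the recursion, so the Bochner integrals in
  \<open>free_energy\<close> are genuine means and not the default value 0.\<close>

lemma nn_expect_eq_integral:
  assumes \<mu>: "nonneg_law \<mu>" and fin: "nn_expect \<mu> < \<infinity>"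
  shows "nn_expect (law_at N \<mu> n) = ennreal (\<integral>x. x \<partial>law_at N \<mu> n)" "0 \<le> (\<integral>x. x \<partial>law_at N \<mu> n)"
proof -
  have [measurable_cong]: "sets (law_at N \<mu> n) = sets borel" and nn: "AE x in law_at N \<mu> n. 0 \<le> x"
    using nonneg_at[OF \<mu>, of n] by (simp_all add: nonneg_law_def)
  have fin: "nn_expect (law_at N \<mu> n) < \<infinity>"
  proof (induction n)
    case (Suc n)
    have "nn_expect (law_at N \<mu> (Suc n)) \<le> ennreal m * nn_expect (law_at N \<mu> n)"
      using nn_expect_next_le[OF nonneg_at[OF \<mu>]] by simp
    also have "\<dots> < \<infinity>" using Suc by (simp add: ennreal_mult_less_top)
    finally show ?case .
  qed (use fin in simp)
  have "integrable (law_at N \<mu> n) (\<lambda>x. x)"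
    using fin nn by (intro integrableI_nonneg) auto
  then show "nn_expect (law_at N \<mu> n) = ennreal (\<integral>x. x \<partial>law_at N \<mu> n)" using nn by (intro nn_integral_eq_integral)
  show "0 \<le> (\<integral>x. x \<partial>law_at N \<mu> n)" using nn by (intro integral_nonneg_AE)
qed

text \<open>The means \<open>e n\<close> satisfy
  \<open>m * e n - 1 \<le> e (Suc n) \<le> m * e n\<close>. The fixed point of
  \<open>e \<mapsto> m * e - 1\<close> is \<open>1 / (m - 1)\<close>, so subtracting it before
  dividing by \<open>m ^ n\<close> turns the nonincreasing sequence into a nondecreasing
  one.\<close>

lemma normalized_mean_limit:
  assumes \<mu>: "nonneg_law \<mu>" and fin: "nn_expect \<mu> < \<infinity>"
  shows "lim (normalized_mean \<mu>) \<le> normalized_mean \<mu> n"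
    and "normalized_mean \<mu> n - 1 / ((m - 1) * m ^ n) \<le> lim (normalized_mean \<mu>)"
proof -
  define e where "e n = (\<integral>x. x \<partial>law_at N \<mu> n)" for n
  have e: "nn_expect (law_at N \<mu> n) = ennreal (e n)" "0 \<le> e n" for n
    using nn_expect_eq_integral[OF \<mu> fin, of n] by (simp_all add: e_def)
  have e1: "e (Suc n) \<le> m * e n" for n
    using nn_expect_next_le[OF nonneg_at[OF \<mu>], of n] e(2)[of n] m_gt_1
    unfolding law_at.simps(2)[symmetric] e by (simp add: ennreal_mult[symmetric])
  have e2: "m * e n \<le> e (Suc n) + 1" for n
  proof -
    have "ennreal (m * e n) \<le> ennreal (e (Suc n) + 1)"
      using nn_expect_next_ge[OF nonneg_at[OF \<mu>], of n] e(2) m_gt_1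
      unfolding law_at.simps(2)[symmetric] e by (simp add: ennreal_mult)
    then show ?thesis using e(2)[of "Suc n"] by (subst (asm) ennreal_le_iff) auto
  qed
  have a: "normalized_mean \<mu> n = e n / m ^ n" for n by (simp add: normalized_mean_def e_def)
  have mp: "0 < m ^ n" for n using m_gt_1 by simp
  have dec: "decseq (normalized_mean \<mu>)"
  proof (rule decseq_SucI)
    fix n
    have "e (Suc n) / m ^ Suc n \<le> (m * e n) / m ^ Suc n" using e1[of n] m_gt_1 by (intro divide_right_mono) auto
    then show "normalized_mean \<mu> (Suc n) \<le> normalized_mean \<mu> n" using m_gt_1 by (simp add: a)
  qed
  have "\<bar>normalized_mean \<mu> n\<bar> \<le> normalized_mean \<mu> 0" for n
    using decseqD[OF dec, of 0 n] e(2)[of n] mp[of n] by (simp add: a)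
  then have "Bseq (normalized_mean \<mu>)" by (intro BseqI'[of _ "normalized_mean \<mu> 0"]) auto
  then have conv: "normalized_mean \<mu> \<longlonglongrightarrow> lim (normalized_mean \<mu>)"
    using Bseq_monoseq_convergent dec decseq_imp_monoseq convergent_LIMSEQ_iff by blast
  show "lim (normalized_mean \<mu>) \<le> normalized_mean \<mu> n" by (rule decseq_ge[OF dec conv])
  let ?b = "\<lambda>n. normalized_mean \<mu> n - 1 / ((m - 1) * m ^ n)"
  have inc: "incseq ?b"
  proof (rule incseq_SucI)
    fix n
    have "?b n = (m * e n - 1 - 1 / (m - 1)) / m ^ Suc n" using m_gt_1 by (simp add: a field_simps)
    also have "\<dots> \<le> (e (Suc n) - 1 / (m - 1)) / m ^ Suc n"
      using e2[of n] m_gt_1 by (intro divide_right_mono) auto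
    also have "\<dots> = ?b (Suc n)" using m_gt_1 by (simp add: a field_simps)
    finally show "?b n \<le> ?b (Suc n)" .
  qed
  have "?b n \<le> normalized_mean \<mu> k" if "n \<le> k" for k
  proof -
    have "?b n \<le> ?b k" using incseqD[OF inc that] by simp
    also have "\<dots> \<le> normalized_mean \<mu> k" using m_gt_1 by simp
    finally show ?thesis .
  qed
  then show "?b n \<le> lim (normalized_mean \<mu>)" by (intro LIMSEQ_le_const[OF conv]) auto
qed

text \<open>A mean that exceeds the fixed point \<open>1 / (m - 1)\<close> by more than 1 at time
  \<open>n\<close> secures at least \<open>1 / m ^ n\<close> in the limit.\<close>

lemma lim_normalized_mean_ge:
  fixes L j :: nat
  assumes \<mu>: "nonneg_law \<mu>" and fin: "nn_expect \<mu> < \<infinity>" and a: "a = 1 / (m - 1) + 1"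
    and ex: "\<exists>n\<le>k. ennreal a < nn_expect (law_at N \<mu> n)"
  shows "1 / m ^ k \<le> lim (normalized_mean \<mu>)"
proof -
  from ex obtain n where n: "n \<le> k" "ennreal a < ennreal (\<integral>x. x \<partial>law_at N \<mu> n)"
    using nn_expect_eq_integral(1)[OF \<mu> fin] by auto
  then have an: "a < (\<integral>x. x \<partial>law_at N \<mu> n)"
    using a m_gt_1 by (subst (asm) ennreal_less_iff) auto
  have "1 / m ^ k \<le> 1 / m ^ n" using n m_gt_1 by (intro divide_left_mono power_increasing) auto
  also have "\<dots> = (a - 1 / (m - 1)) / m ^ n" by (simp add: a)
  also have "\<dots> \<le> ((\<integral>x. x \<partial>law_at N \<mu> n) - 1 / (m - 1)) / m ^ n"
    using an m_gt_1 by (intro divide_right_mono) auto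
  also have "\<dots> = normalized_mean \<mu> n - 1 / ((m - 1) * m ^ n)"
    by (simp add: normalized_mean_def diff_divide_distrib)
  also have "\<dots> \<le> lim (normalized_mean \<mu>)" by (rule normalized_mean_limit(2)[OF \<mu> fin])
  finally show ?thesis .
qed

lemma lim_normalized_mean_le:
  "\<exists>\<delta>>0. \<forall>\<mu> (L::nat). nonneg_law \<mu> \<longrightarrow> nn_expect \<mu> < \<infinity> \<longrightarrow> 1 < m * exp (- 1 / real L) \<longrightarrow> 1 \<le> L \<longrightarrow>
     (\<integral>\<^sup>+x. ennreal (moment_fun (m * exp (- 1 / real L)) x) \<partial>\<mu>) \<le> ennreal \<delta> \<longrightarrow>
     lim (normalized_mean \<mu>) \<le> 1 / m ^ L"
proof -
  obtain \<delta>0 where \<delta>0: "0 < \<delta>0" and step: "\<And>s \<mu>. nonneg_law \<mu> \<Longrightarrow> 1 < s \<Longrightarrow> s \<le> m \<Longrightarrow> (\<integral>\<^sup>+x. ennreal (moment_fun s x) \<partial>\<mu>) \<le> ennreal \<delta>0 \<Longrightarrow>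
     (\<integral>\<^sup>+x. ennreal (moment_fun s x) \<partial>next_law N \<mu>) \<le> ennreal (m / s) * (\<integral>\<^sup>+x. ennreal (moment_fun s x) \<partial>\<mu>)"
    using moment_next_le by blast
  \<comment> \<open>Over \<open>L\<close> steps the moment grows at most by the factor
    \<open>exp 1\<close>. Dividing by it keeps the moment within the range of the one-step bound and
    the final mean at most 1.\<close>
  define \<delta> where "\<delta> = min 1 \<delta>0 / exp 1"
  have \<delta>: "0 < \<delta>" "exp 1 * \<delta> \<le> \<delta>0" "exp 1 * \<delta> \<le> 1" using \<delta>0 by (auto simp: \<delta>_def)
  show ?thesis
  proof (intro exI[of _ \<delta>] conjI \<delta>(1) allI impI)
    fix \<mu> and L :: nat
    assume \<mu>: "nonneg_law \<mu>" and fin: "nn_expect \<mu> < \<infinity>" and s1: "1 < m * exp (- 1 / real L)" and L: "1 \<le> L"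
      and start: "(\<integral>\<^sup>+x. ennreal (moment_fun (m * exp (- 1 / real L)) x) \<partial>\<mu>) \<le> ennreal \<delta>"
    define s where "s = m * exp (- 1 / real L)"
    have s: "1 < s" "s \<le> m" "m / s = exp (1 / real L)"
      using s1 m_gt_1 by (auto simp: s_def exp_minus field_simps)
    have le: "(\<integral>\<^sup>+x. ennreal (moment_fun s x) \<partial>law_at N \<mu> n) \<le> ennreal (exp (real n / real L) * \<delta>)" if "n \<le> L" for n
      using that
    proof (induction n)
      case 0
      then show ?case using start by (simp add: s_def)
    next
      case (Suc n)
      have "exp (real n / real L) * \<delta> \<le> exp 1 * \<delta>" using Suc.prems L \<delta> by (intro mult_right_mono) auto
      then have "exp (real n / real L) * \<delta> \<le> \<delta>0" using \<delta> by linarith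
      then have "(\<integral>\<^sup>+x. ennreal (moment_fun s x) \<partial>law_at N \<mu> n) \<le> ennreal \<delta>0"
        using Suc order_trans ennreal_leI by (metis Suc_leD)
      then have "(\<integral>\<^sup>+x. ennreal (moment_fun s x) \<partial>law_at N \<mu> (Suc n)) \<le> ennreal (m / s) * (\<integral>\<^sup>+x. ennreal (moment_fun s x) \<partial>law_at N \<mu> n)"
        using step[OF nonneg_at[OF \<mu>] s(1,2)] by simp
      also have "\<dots> \<le> ennreal (m / s) * ennreal (exp (real n / real L) * \<delta>)"
        using Suc by (intro mult_left_mono) auto
      also have "\<dots> = ennreal (exp (real (Suc n) / real L) * \<delta>)"
        using \<delta> s by (simp add: ennreal_mult[symmetric] exp_add[symmetric] add_divide_distrib mult.assoc[symmetric])
      finally show ?case .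
    qed
    have nn: "AE x in law_at N \<mu> L. 0 \<le> x" using nonneg_at[OF \<mu>, of L] by (simp_all add: nonneg_law_def)
    have "nn_expect (law_at N \<mu> L) \<le> (\<integral>\<^sup>+x. ennreal (moment_fun s x) \<partial>law_at N \<mu> L)"
    proof (intro nn_integral_mono_AE, use nn in eventually_elim)
      case (elim x)
      have "x * 1 \<le> x * s powr x" using elim s by (intro mult_left_mono ge_one_powr_ge_zero) auto
      then show ?case by (simp add: moment_fun_def ennreal_leI)
    qed
    also have "\<dots> \<le> ennreal (exp (real L / real L) * \<delta>)" by (rule le) simp
    also have "\<dots> \<le> ennreal 1" using \<delta> L by (intro ennreal_leI) auto
    finally have "(\<integral>x. x \<partial>law_at N \<mu> L) \<le> 1"
      by (simp add: nn_expect_eq_integral[OF \<mu> fin])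
    then have "normalized_mean \<mu> L \<le> 1 / m ^ L"
      unfolding normalized_mean_def using m_gt_1 by (intro divide_right_mono) auto
    then show "lim (normalized_mean \<mu>) \<le> 1 / m ^ L"
      using normalized_mean_limit(1)[OF \<mu> fin, of L] by linarith
  qed
qed

end

section \<open>Moments of the initial law\<close>

lemma nn_integral_initial_law:
  assumes Q: "sets Q = sets borel" and p: "p \<in> {0..1}" and f: "f \<in> borel_measurable borel"
  shows "(\<integral>\<^sup>+x. f x \<partial>initial_law Q p) = ennreal (1 - p) * f 0 + ennreal p * (\<integral>\<^sup>+x. f x \<partial>Q)"
  using f
proof (induction rule: borel_measurable_induct)
  case (cong f g)
  then have "f = g" by auto
  with cong show ?case by simp
next
  case (set A)
  then show ?case using emeasure_initial_law[OF Q, of A p] Q by simp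
next
  case (mult u c)
  have [measurable_cong]: "sets Q = sets borel" by fact
  note [measurable] = mult(2)
  show ?case by (simp add: nn_integral_cmult mult distrib_left mult_ac)
next
  case (add u v)
  have [measurable_cong]: "sets Q = sets borel" by fact
  have [measurable]: "u \<in> borel_measurable borel" "v \<in> borel_measurable borel" using add by auto
  show ?case by (simp add: nn_integral_add add algebra_simps)
next
  case (seq U)
  have [measurable_cong]: "sets Q = sets borel" by fact
  note [measurable] = seq(1)
  have incU: "incseq U" by fact
  have inc: "incseq (\<lambda>i. U i x)" for x using incU by (auto simp: incseq_def le_fun_def)
  have incI: "incseq (\<lambda>i. \<integral>\<^sup>+x. U i x \<partial>Q)"
    using inc by (auto simp: incseq_def intro!: nn_integral_mono)
  have "(\<integral>\<^sup>+x. (SUP i. U i) x \<partial>initial_law Q p) = (SUP i. \<integral>\<^sup>+x. U i x \<partial>initial_law Q p)"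
    using incU by (simp add: nn_integral_monotone_convergence_SUP image_comp)
  also have "\<dots> = (SUP i. ennreal (1 - p) * U i 0 + ennreal p * (\<integral>\<^sup>+x. U i x \<partial>Q))"
    by (simp add: seq)
  also have "\<dots> = (SUP i. ennreal (1 - p) * U i 0) + (SUP i. ennreal p * (\<integral>\<^sup>+x. U i x \<partial>Q))"
    using inc incI by (intro ennreal_SUP_add) (auto simp: incseq_def intro!: mult_left_mono)
  also have "\<dots> = ennreal (1 - p) * (SUP i. U i) 0 + ennreal p * (\<integral>\<^sup>+x. (SUP i. U i) x \<partial>Q)"
    using incU by (simp add: SUP_mult_left_ennreal[symmetric] nn_integral_monotone_convergence_SUP image_comp)
  finally show ?case by (simp add: image_comp)
qed

lemma nonneg_law_initial_law:
  assumes Q: "nonneg_law Q" and p: "p \<in> {0..1}"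
  shows "nonneg_law (initial_law Q p)"
proof -
  have s: "sets Q = sets borel" and [measurable_cong]: "sets Q = sets borel" and Q0: "prob_space Q" "AE x in Q. 0 \<le> x"
    using Q by (simp_all add: nonneg_law_def)
  have "emeasure Q {x \<in> space Q. \<not> 0 \<le> x} = 0"
    using Q0(2) by (subst (asm) AE_iff_measurable[OF _ refl]) auto
  moreover have "{x \<in> space Q. \<not> 0 \<le> x} = {..<0}" using sets_eq_imp_space_eq[OF s] by auto
  ultimately have "emeasure (initial_law Q p) {..<0} = 0" by (simp add: emeasure_initial_law[OF s])
  then have "AE x in initial_law Q p. 0 \<le> x"
    by (subst AE_iff_measurable[of "{..<0}"]) auto
  then show ?thesis
    using prob_space_initial_law[OF Q0(1) s p] by (simp add: nonneg_law_def)
qed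

text \<open>The inequality \<open>y \<le> exp y\<close> at \<open>y = x / \<beta>\<close>, raised to
  the power \<open>\<beta>\<close>. It serves to trade the factor exp(-k/L) for a power of
  L/k.\<close>

lemma powr_le_exp:
  fixes x \<beta> :: real
  assumes "0 < x" "0 < \<beta>"
  shows "x powr \<beta> \<le> \<beta> powr \<beta> * exp x"
proof -
  have "x / \<beta> \<le> exp (x / \<beta>)" using exp_ge_add_one_self[of "x / \<beta>"] by linarith
  then have "(x / \<beta>) powr \<beta> \<le> exp (x / \<beta>) powr \<beta>" using assms by (intro powr_mono2) auto
  then show ?thesis using assms by (simp add: powr_divide powr_def[of "exp (x / \<beta>)"] field_simps)
qed

text \<open>Summation by parts: the increment of \<open>i * s ^ i\<close> at \<open>k\<close> is at
  least \<open>k * s ^ k * (s - 1)\<close>, and the indicators keep the increments below the integer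
  part of \<open>y\<close>.\<close>

lemma capped_moment_fun_ge_sum:
  assumes s: "1 < s" and y: "0 \<le> y" and K: "real K \<le> R"
  shows "(\<Sum>k<K. real k * s ^ k * (s - 1) * indicator {real k + 1..} y) \<le> capped_moment_fun s R y"
proof -
  have "(\<Sum>k<i. real k * s ^ k * (s - 1)) \<le> real i * s ^ i" for i
  proof (induction i)
    case (Suc i)
    then have "(\<Sum>k<Suc i. real k * s ^ k * (s - 1)) \<le> real i * s ^ i + real i * s ^ i * (s - 1)" by simp
    also have "\<dots> = real i * s ^ Suc i" by (simp add: algebra_simps)
    also have "\<dots> \<le> real (Suc i) * s ^ Suc i" using s by (intro mult_right_mono) auto
    finally show ?case .
  qed simp
  note A = this
  define i where "i = min K (nat \<lfloor>y\<rfloor>)"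
  have i: "real i \<le> y" "real i \<le> R" using y K by (auto simp: i_def min_def intro: order_trans[OF of_nat_mono])
  have "(\<Sum>k<K. real k * s ^ k * (s - 1) * indicator {real k + 1..} y) = (\<Sum>k<i. real k * s ^ k * (s - 1))"
  proof (intro sum.mono_neutral_cong_right)
    show "\<forall>k\<in>{..<K} - {..<i}. real k * s ^ k * (s - 1) * indicator {real k + 1..} y = 0"
      unfolding i_def by (auto simp: indicator_def) linarith
    show "real k * s ^ k * (s - 1) * indicator {real k + 1..} y = real k * s ^ k * (s - 1)" if "k \<in> {..<i}" for k
    proof -
      have "real (Suc k) \<le> real i" using that by (intro of_nat_mono) auto
      then have "real k + 1 \<le> y" using i(1) by simp
      then show ?thesis by simp
    qed
  qed (auto simp: i_def)
  also have "\<dots> \<le> real i * s ^ i" by (rule A)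
  also have "\<dots> = real i * s powr real i" using s by (simp add: powr_realpow)
  also have "\<dots> \<le> y * s powr min y R" using i y s by (intro mult_mono powr_mono) auto
  finally show ?thesis by (simp add: capped_moment_fun_def)
qed

text \<open>Only \<open>k\<close> in the upper half of the range below \<open>L\<close> are kept.
  There \<open>(s / m) ^ k\<close> is at least \<open>exp (- 1)\<close> and \<open>k\<close> is
  comparable to \<open>L\<close>, so about L/2 terms of order L^(alpha+1) are summed.\<close>

lemma capped_moment_lower_bound:
  fixes m c \<alpha> :: real and k0 :: nat
  assumes Q: "nonneg_law Q" and m: "1 < m" and c: "0 < c"
    and tail: "\<And>k. k0 \<le> k \<Longrightarrow> c * real k powr \<alpha> * m powr - real k \<le> measure Q {real k..}"
  shows "\<exists>b>0. \<forall>\<^sub>F L in sequentially. \<forall>R\<ge>real L.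
    ennreal (b * real L powr (\<alpha> + 2)) \<le> (\<integral>\<^sup>+x. ennreal (capped_moment_fun (m * exp (- 1 / real L)) R x) \<partial>Q)"
proof -
  \<comment> \<open>\<open>exp (- 1)\<close> bounds \<open>(s / m) ^ k\<close>,
    \<open>sqrt m - 1\<close> bounds \<open>s - 1\<close>, the power of 2 accounts for replacing
    \<open>k + 1\<close> by \<open>L\<close> under the exponent \<open>\<alpha>\<close>, and
    \<open>1 / m\<close> for the tail being taken at \<open>k + 1\<close>. The 8 is 2 from
    \<open>L / 2 \<le> k\<close> times 4 from \<open>L / 4 \<le> L div 2\<close>.\<close>
  define b where "b = exp (- 1) * (sqrt m - 1) * c * 2 powr (- \<bar>\<alpha>\<bar>) / m / 8"
  have b: "0 < b" using m c by (auto simp: b_def)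
  interpret prob_space Q using Q by (simp add: nonneg_law_def)
  have [measurable_cong]: "sets Q = sets borel" and nn: "AE x in Q. 0 \<le> x" using Q by (simp_all add: nonneg_law_def)
  have "(\<lambda>L. m * exp (- 1 / real L)) \<longlonglongrightarrow> m * exp 0"
    by (intro tendsto_intros)
  moreover have "sqrt m < m * exp 0" using m real_less_lsqrt[of m m] by (simp add: power2_eq_square)
  ultimately have ev: "\<forall>\<^sub>F L in sequentially. sqrt m < m * exp (- 1 / real L)" by (rule order_tendstoD)
  have "\<forall>\<^sub>F L in sequentially. \<forall>R\<ge>real L.
    ennreal (b * real L powr (\<alpha> + 2)) \<le> (\<integral>\<^sup>+x. ennreal (capped_moment_fun (m * exp (- 1 / real L)) R x) \<partial>Q)"
    using ev eventually_ge_at_top[of "2 * k0 + 2"]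
  proof (eventually_elim, intro allI impI)
    case (elim L)
    fix R assume R: "real L \<le> R"
    define s where "s = m * exp (- 1 / real L)"
    have "1 < sqrt m" using m by simp
    moreover have "sqrt m < s" using elim by (simp add: s_def)
    ultimately have s: "sqrt m < s" "1 < s" "0 < s" by linarith+
    have L: "2 \<le> L" using elim by simp
    let ?t = "\<lambda>k. real k * s ^ k * (s - 1)"
    define u where "u = real L / 2 * exp (- 1) * (sqrt m - 1) * (c * (2 powr (- \<bar>\<alpha>\<bar>) * real L powr \<alpha>) / m)"
    have bnd: "u \<le> ?t k * measure Q {real k + 1..}" if k: "k \<in> {L - L div 2..<L}" for k
    proof -
      have kL: "real L / 2 \<le> real k" "real k + 1 \<le> real L" "k0 \<le> k + 1" using k elim by auto
      have e: "exp (- 1) \<le> (s / m) ^ k"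
      proof -
        have "(s / m) ^ k = exp (- (real k / real L))" using m by (simp add: s_def flip: exp_of_nat_mult)
        moreover have "real k / real L \<le> 1" using kL L by simp
        ultimately show ?thesis by simp
      qed
      have "2 powr (- \<bar>\<alpha>\<bar>) \<le> ((real k + 1) / real L) powr \<alpha>"
      proof (cases "0 \<le> \<alpha>")
        case True
        have "(1 / 2) powr \<alpha> \<le> ((real k + 1) / real L) powr \<alpha>"
          using True kL L by (intro powr_mono2) (auto simp: field_simps)
        then show ?thesis using True by (simp add: powr_minus powr_divide divide_simps)
      next
        case False
        have "2 powr (- \<bar>\<alpha>\<bar>) \<le> 2 powr 0" by (intro powr_mono) auto
        also have "\<dots> \<le> ((real k + 1) / real L) powr \<alpha>"
          using powr_mono2'[of \<alpha> "(real k + 1) / real L" 1] False kL L by (auto simp: field_simps)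
        finally show ?thesis .
      qed
      then have pw: "2 powr (- \<bar>\<alpha>\<bar>) * real L powr \<alpha> \<le> (real k + 1) powr \<alpha>"
        using L by (simp add: powr_divide field_simps)
      have "u \<le> real k * (s / m) ^ k * (s - 1) * (c * (real k + 1) powr \<alpha> / m)"
        unfolding u_def using kL e s m c pw
        by (intro mult_mono divide_right_mono) (auto intro!: mult_nonneg_nonneg divide_nonneg_nonneg)
      also have "\<dots> = ?t k * (c * real (k + 1) powr \<alpha> * m powr - real (k + 1))"
      proof -
        have "m powr - real (k + 1) = 1 / (m * m ^ k)"
          using m by (subst powr_minus, subst powr_realpow) (auto simp: field_simps)
        then show ?thesis by (simp only:) (simp add: power_divide add.commute)
      qed
      also have "\<dots> \<le> ?t k * measure Q {real (k + 1)..}"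
        using s kL by (intro mult_left_mono tail) auto
      finally show ?thesis by (simp add: add.commute)
    qed
    have "b * real L powr (\<alpha> + 2) \<le> real (L div 2) * u"
    proof -
      have "real L / 4 * u = b * real L powr (\<alpha> + 2)"
        using L m by (simp add: u_def b_def powr_add power2_eq_square mult_ac)
      moreover have "real L / 4 \<le> real (L div 2)" using L by linarith
      moreover have "0 \<le> u" unfolding u_def using m c L by (auto intro!: mult_nonneg_nonneg)
      ultimately show ?thesis by (metis mult_right_mono)
    qed
    also have "\<dots> = (\<Sum>k\<in>{L - L div 2..<L}. u)" by simp
    also have "\<dots> \<le> (\<Sum>k\<in>{L - L div 2..<L}. ?t k * measure Q {real k + 1..})" by (intro sum_mono bnd)
    also have "\<dots> \<le> (\<Sum>k<L. ?t k * measure Q {real k + 1..})"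
      using s by (intro sum_mono2) (auto intro!: mult_nonneg_nonneg)
    finally have "ennreal (b * real L powr (\<alpha> + 2)) \<le> ennreal (\<Sum>k<L. ?t k * measure Q {real k + 1..})"
      by (rule ennreal_leI)
    also have "\<dots> = (\<Sum>k<L. ennreal (?t k) * emeasure Q {real k + 1..})"
      using s by (subst sum_ennreal[symmetric]) (auto simp: ennreal_mult emeasure_eq_measure)
    also have "\<dots> = (\<integral>\<^sup>+x. (\<Sum>k<L. ennreal (?t k) * indicator {real k + 1..} x) \<partial>Q)"
      by (subst nn_integral_sum) (auto simp: nn_integral_cmult)
    also have "\<dots> \<le> (\<integral>\<^sup>+x. ennreal (capped_moment_fun s R x) \<partial>Q)"
    proof (intro nn_integral_mono_AE, use nn in eventually_elim)
      case (elim x)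
      have "(\<Sum>k<L. ennreal (?t k) * indicator {real k + 1..} x) = ennreal (\<Sum>k<L. ?t k * indicator {real k + 1..} x)"
        using s by (subst sum_ennreal[symmetric]) (auto simp: ennreal_mult ennreal_indicator intro!: sum.cong)
      also have "\<dots> \<le> ennreal (capped_moment_fun s R x)"
        by (intro ennreal_leI capped_moment_fun_ge_sum s elim R)
      finally show ?case .
    qed
    finally show "ennreal (b * real L powr (\<alpha> + 2)) \<le> (\<integral>\<^sup>+x. ennreal (capped_moment_fun (m * exp (- 1 / real L)) R x) \<partial>Q)"
      by (simp add: s_def)
  qed
  with b show ?thesis by blast
qed

text \<open>Slicing at integers gives a sum of terms k^(alpha+1) exp(-k/L). Replacing the
  exponential by a constant times (L/k)^beta pulls out \<open>real L powr \<beta>\<close>, and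
  \<open>\<alpha> + 2 < \<beta>\<close> is what makes the remaining series converge.\<close>

lemma moment_upper_bound:
  fixes m c \<alpha> \<beta> :: real
  assumes Q: "nonneg_law Q" and m: "1 < m" and c: "0 \<le> c" and \<beta>: "\<alpha> + 2 < \<beta>" "0 < \<beta>"
    and tail: "\<And>k. 1 \<le> k \<Longrightarrow> measure Q {real k..} \<le> c * real k powr \<alpha> * m powr - real k"
  shows "\<exists>b>0. \<forall>L::nat. 1 \<le> L \<longrightarrow> 1 < m * exp (- 1 / real L) \<longrightarrow>
    (\<integral>\<^sup>+x. ennreal (moment_fun (m * exp (- 1 / real L)) x) \<partial>Q) \<le> ennreal (b * real L powr \<beta>)"
proof -
  interpret prob_space Q using Q by (simp add: nonneg_law_def)
  have [measurable_cong]: "sets Q = sets borel" and nn: "AE x in Q. 0 \<le> x" using Q by (simp_all add: nonneg_law_def)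
  define \<gamma> where "\<gamma> = \<beta> - \<alpha> - 2"
  have \<gamma>: "0 < \<gamma>" using \<beta> by (simp add: \<gamma>_def)
  \<comment> \<open>The slice \<open>k = 0\<close> needs the separate term \<open>m\<close>: the
    tail bound starts at 1, and \<open>0 powr _\<close> is 0.\<close>
  define g where "g k = (if k = 0 then m else 0) + 2 * m * c * \<beta> powr \<beta> * real k powr (- 1 - \<gamma>)" for k :: nat
  have g0: "0 \<le> g k" for k using m c by (simp add: g_def)
  have sum_g: "summable g"
  proof -
    have "summable (\<lambda>k. if k = (0::nat) then m else 0)" by (rule summable_finite[of "{0}"]) auto
    moreover have "summable (\<lambda>k. real k powr (- 1 - \<gamma>))" using \<gamma> by (simp add: summable_real_powr_iff)
    ultimately show ?thesis unfolding g_def by (intro summable_add summable_mult)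
  qed
  define b where "b = suminf g + 1"
  have b: "0 < b" unfolding b_def using suminf_nonneg[OF sum_g g0] by simp
  show ?thesis
  proof (intro exI[of _ b] conjI b allI impI)
    fix L :: nat assume L: "1 \<le> L" and s1: "1 < m * exp (- 1 / real L)"
    define s where "s = m * exp (- 1 / real L)"
    have s: "1 < s" "s \<le> m" using s1 m by (auto simp: s_def)
    have Lb: "1 \<le> real L powr \<beta>" using L \<beta> by (intro ge_one_powr_ge_zero) auto
    have bnd: "(real k + 1) * s ^ (k + 1) * measure Q {real k..} \<le> real L powr \<beta> * g k" for k
    proof (cases "k = 0")
      case True
      have "s * measure Q {0..} \<le> m * 1" using s by (intro mult_mono) auto
      also have "\<dots> \<le> real L powr \<beta> * m" using Lb m by simp
      finally show ?thesis using True by (simp add: g_def)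
    next
      case False
      then have k: "1 \<le> k" by simp
      have "(real k / real L) powr \<beta> \<le> \<beta> powr \<beta> * exp (real k / real L)" using k L \<beta> by (intro powr_le_exp) auto
      then have e: "real k powr \<beta> * exp (- (real k / real L)) \<le> \<beta> powr \<beta> * real L powr \<beta>"
        using L by (simp add: powr_divide exp_minus field_simps)
      have sk: "s ^ (k + 1) * m powr - real k = s * exp (- (real k / real L))"
      proof -
        have "s ^ k = m ^ k * exp (- (real k / real L))" by (simp add: s_def power_mult_distrib flip: exp_of_nat_mult)
        then show ?thesis using m by (simp add: powr_minus powr_realpow)
      qed
      have "(real k + 1) * s ^ (k + 1) * measure Q {real k..} \<le> (real k + 1) * s ^ (k + 1) * (c * real k powr \<alpha> * m powr - real k)"
        using s k by (intro mult_left_mono tail) auto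
      also have "\<dots> = (real k + 1) * (c * real k powr \<alpha> * (s ^ (k + 1) * m powr - real k))" by (simp add: mult_ac)
      also have "\<dots> \<le> (2 * real k) * (c * real k powr \<alpha> * (m * exp (- (real k / real L))))"
        unfolding sk using k s c by (intro mult_mono) auto
      also have "\<dots> = 2 * m * c * real k powr (- 1 - \<gamma>) * (real k powr \<beta> * exp (- (real k / real L)))"
      proof -
        have "real k powr \<alpha> * real k = real k powr (- 1 - \<gamma>) * real k powr \<beta>"
          using k unfolding \<gamma>_def by (simp flip: powr_add add: powr_mult_base mult.commute)
        then show ?thesis by (simp add: mult_ac)
      qed
      also have "\<dots> \<le> 2 * m * c * real k powr (- 1 - \<gamma>) * (\<beta> powr \<beta> * real L powr \<beta>)"
        using m c by (intro mult_left_mono e) auto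
      finally show ?thesis using False by (simp add: g_def mult_ac)
    qed
    have le_sum: "f k \<le> (\<Sum>k. f k)" for f :: "nat \<Rightarrow> ennreal" and k
      using sum_le_suminf[OF summableI, of "{k}" f] by simp
    have "(\<integral>\<^sup>+x. ennreal (moment_fun s x) \<partial>Q) \<le> (\<integral>\<^sup>+x. (\<Sum>k. ennreal ((real k + 1) * s ^ (k + 1)) * indicator {real k..} x) \<partial>Q)"
    proof (intro nn_integral_mono_AE, use nn in eventually_elim)
      case (elim x)
      define k where "k = nat \<lfloor>x\<rfloor>"
      have k: "real k \<le> x" "x \<le> real k + 1" using elim by (auto simp: k_def)
      have "s powr x \<le> s powr (real (k + 1))" using k s by (intro powr_mono) auto
      then have "s powr x \<le> s ^ (k + 1)" using s by (simp only: powr_realpow)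
      then have "moment_fun s x \<le> (real k + 1) * s ^ (k + 1)"
        unfolding moment_fun_def using k elim by (intro mult_mono) auto
      then have "ennreal (moment_fun s x) \<le> ennreal ((real k + 1) * s ^ (k + 1)) * indicator {real k..} x"
        using k by (simp add: ennreal_leI)
      also have "\<dots> \<le> (\<Sum>k. ennreal ((real k + 1) * s ^ (k + 1)) * indicator {real k..} x)"
        by (rule le_sum)
      finally show ?case .
    qed
    also have "\<dots> = (\<Sum>k. ennreal ((real k + 1) * s ^ (k + 1)) * emeasure Q {real k..})"
      by (subst nn_integral_suminf) (auto simp: nn_integral_cmult)
    also have "\<dots> \<le> (\<Sum>k. ennreal (real L powr \<beta> * g k))"
    proof (intro suminf_le summableI)
      fix k
      have "ennreal ((real k + 1) * s ^ (k + 1)) * emeasure Q {real k..} = ennreal ((real k + 1) * s ^ (k + 1) * measure Q {real k..})"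
        using s by (simp only: emeasure_eq_measure) (subst ennreal_mult, auto)
      also have "\<dots> \<le> ennreal (real L powr \<beta> * g k)" by (intro ennreal_leI bnd)
      finally show "ennreal ((real k + 1) * s ^ (k + 1)) * emeasure Q {real k..} \<le> ennreal (real L powr \<beta> * g k)" .
    qed
    also have "\<dots> = ennreal (real L powr \<beta> * suminf g)"
      using g0 sum_g by (subst suminf_ennreal2) (auto simp: suminf_mult)
    also have "\<dots> \<le> ennreal (b * real L powr \<beta>)"
      unfolding b_def by (intro ennreal_leI) (simp add: algebra_simps)
    finally show "(\<integral>\<^sup>+x. ennreal (moment_fun (m * exp (- 1 / real L)) x) \<partial>Q) \<le> ennreal (b * real L powr \<beta>)"
      by (simp add: s_def)
  qed
qed

section \<open>Free energy bounds in terms of \<open>p\<close> and the scale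
  \<open>L\<close>\<close>

context offspring_law begin

lemma free_energy_eq_lim: "free_energy N Q p = lim (normalized_mean (initial_law Q p))"
  by (simp add: free_energy_def normalized_mean_def[abs_def] mean)

lemma nn_expect_initial_law:
  assumes "nonneg_law Q" "nn_expect Q < \<infinity>" "p \<in> {0..1}"
  shows "nn_expect (initial_law Q p) < \<infinity>"
  using assms by (simp add: nn_integral_initial_law nonneg_law_def ennreal_mult_less_top)

text \<open>With \<open>j\<close> the upper integer part of \<open>real L powr \<delta>\<close>,
  both smallness conditions of \<open>expectation_exceeds\<close> hold for large \<open>L\<close>,
  since exponentials of a power of \<open>L\<close> beat polynomials. The hypothesis on
  \<open>p\<close> says that the initial moment reaches \<open>growth_threshold\<close>.\<close>

lemma free_energy_ge:
  assumes Q: "nonneg_law Q" and fin: "nn_expect Q < \<infinity>" and c: "0 < c" and \<delta>: "0 < \<delta>"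
    and tail: "\<And>k. k0 \<le> k \<Longrightarrow> c * real k powr \<alpha> * m powr - real k \<le> measure Q {real k..}"
  shows "\<exists>b>0. \<forall>\<^sub>F L in sequentially. \<forall>p\<in>{0..1}. 1 \<le> b * p * real L powr (\<alpha> + 2) \<longrightarrow>
    1 / m ^ (3 * (L * nat \<lceil>real L powr \<delta>\<rceil>)) \<le> free_energy N Q p"
proof -
  obtain b where b: "0 < b" and ev: "\<forall>\<^sub>F L in sequentially. \<forall>R\<ge>real L.
    ennreal (b * real L powr (\<alpha> + 2)) \<le> (\<integral>\<^sup>+x. ennreal (capped_moment_fun (m * exp (- 1 / real L)) R x) \<partial>Q)"
    using capped_moment_lower_bound[OF Q m_gt_1 c tail] by blast
  have [measurable_cong]: "sets Q = sets borel" and sQ: "sets Q = sets borel" using Q by (simp_all add: nonneg_law_def)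
  define a where "a = 1 / (m - 1) + 1"
  have a: "0 \<le> a" using m_gt_1 by (simp add: a_def)
  \<comment> \<open>Stated with the bounds
    \<open>real L powr \<delta> \<le> j \<le> real L powr \<delta> + 1\<close> in place of the
    rounded \<open>j\<close>, so that the limit concerns smooth expressions.\<close>
  have ev1: "\<forall>\<^sub>F L in sequentially. a * m\<^sup>2 * (2 * real L * (real L powr \<delta> + 1) + 1)\<^sup>2 * exp (- (real L * real L powr \<delta> - 1) / real L) < 1"
  proof -
    have "(\<lambda>L. a * m\<^sup>2 * (2 * real L * (real L powr \<delta> + 1) + 1)\<^sup>2 * exp (- (real L * real L powr \<delta> - 1) / real L)) \<longlonglongrightarrow> 0"
      using \<delta> by real_asymp
    then show ?thesis by (rule order_tendstoD) simp
  qed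
  have ev2: "\<forall>\<^sub>F L in sequentially. (m + a * m\<^sup>2 * (2 * real L * (real L powr \<delta> + 1) + 1)\<^sup>2) / (3 / 2) powr (real L powr \<delta>) < 1"
  proof -
    have "(\<lambda>L. (m + a * m\<^sup>2 * (2 * real L * (real L powr \<delta> + 1) + 1)\<^sup>2) / (3 / 2) powr (real L powr \<delta>)) \<longlonglongrightarrow> 0"
      using \<delta> by real_asymp
    then show ?thesis by (rule order_tendstoD) simp
  qed
  have ev3: "\<forall>\<^sub>F L in sequentially. 4 < real L powr \<delta>"
    using \<delta> by real_asymp
  have ev4: "\<forall>\<^sub>F L in sequentially. 2 < real L * ln m"
    using m_gt_1 by real_asymp
  have g: "0 < growth_threshold" using growth_threshold_ge_1 by linarith
  show ?thesis
  proof (intro exI[of _ "b / growth_threshold"] conjI)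
    show "0 < b / growth_threshold" using b g by simp
    show "\<forall>\<^sub>F L in sequentially. \<forall>p\<in>{0..1}. 1 \<le> b / growth_threshold * p * real L powr (\<alpha> + 2) \<longrightarrow>
      1 / m ^ (3 * (L * nat \<lceil>real L powr \<delta>\<rceil>)) \<le> free_energy N Q p"
      using ev ev1 ev2 ev3 ev4 eventually_gt_at_top[of 0]
    proof eventually_elim
      case (elim L)
      show ?case
      proof (intro ballI impI)
        fix p :: real assume p: "p \<in> {0..1}" and prem: "1 \<le> b / growth_threshold * p * real L powr (\<alpha> + 2)"
        define j where "j = nat \<lceil>real L powr \<delta>\<rceil>"
        have j: "real L powr \<delta> \<le> real j" "real j \<le> real L powr \<delta> + 1" "4 \<le> j" "1 \<le> real j"
          using elim(4) unfolding j_def by linarith+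
        have L: "1 \<le> real L" using elim(6) by simp
        have sq: "(2 * real L * real j + 1)\<^sup>2 \<le> (2 * real L * (real L powr \<delta> + 1) + 1)\<^sup>2"
          using j by (intro power_mono add_right_mono mult_left_mono) auto
        let ?\<mu> = "initial_law Q p"
        have \<mu>: "nonneg_law ?\<mu>" by (rule nonneg_law_initial_law[OF Q p])
        let ?s = "m * exp (- 1 / real L)" and ?R = "2 * real L * real j"
        have R: "real L \<le> ?R" using mult_mono[of "real L" "2 * real L" 1 "real j"] j L by simp
        have "growth_threshold \<le> p * (b * real L powr (\<alpha> + 2))" using prem g by (simp add: field_simps)
        then have "ennreal growth_threshold \<le> ennreal (p * (b * real L powr (\<alpha> + 2)))" by (rule ennreal_leI)
        also have "\<dots> = ennreal p * ennreal (b * real L powr (\<alpha> + 2))" using p b by (simp add: ennreal_mult)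
        also have "\<dots> \<le> ennreal p * (\<integral>\<^sup>+x. ennreal (capped_moment_fun ?s ?R x) \<partial>Q)"
          using elim(1) R by (intro mult_left_mono) auto
        also have "\<dots> = (\<integral>\<^sup>+x. ennreal (capped_moment_fun ?s ?R x) \<partial>?\<mu>)"
          by (subst nn_integral_initial_law[OF sQ p]) (auto simp: capped_moment_fun_def)
        finally have start: "ennreal growth_threshold \<le> (\<integral>\<^sup>+x. ennreal (capped_moment_fun ?s ?R x) \<partial>?\<mu>)" .
        have c1: "a * m\<^sup>2 * (2 * real L * real j + 1)\<^sup>2 * exp (- (real L * real j - 1) / real L) \<le> 1"
        proof -
          have "- (real L * real j - 1) / real L \<le> - (real L * real L powr \<delta> - 1) / real L"
            using j L by (intro divide_right_mono) auto
          then have "a * m\<^sup>2 * (2 * real L * real j + 1)\<^sup>2 * exp (- (real L * real j - 1) / real L)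
            \<le> a * m\<^sup>2 * (2 * real L * (real L powr \<delta> + 1) + 1)\<^sup>2 * exp (- (real L * real L powr \<delta> - 1) / real L)"
            using a sq by (intro mult_mono) auto
          then show ?thesis using elim(2) by linarith
        qed
        have c2: "m + a * m\<^sup>2 * (2 * real L * real j + 1)\<^sup>2 < (3 / 2) ^ j"
        proof -
          have "m + a * m\<^sup>2 * (2 * real L * real j + 1)\<^sup>2 \<le> m + a * m\<^sup>2 * (2 * real L * (real L powr \<delta> + 1) + 1)\<^sup>2"
            using a sq by (intro add_left_mono mult_left_mono) auto
          also have "\<dots> < (3 / 2) powr (real L powr \<delta>)" using elim(3) by (simp add: field_simps)
          also have "\<dots> \<le> (3 / 2) powr real j" using j by (intro powr_mono) auto
          also have "\<dots> = (3 / 2) ^ j" by (simp add: powr_realpow)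
          finally show ?thesis .
        qed
        have "\<exists>n\<le>3 * (L * j). ennreal a < nn_expect (law_at N ?\<mu> n)"
          using elim(5) by (intro expectation_exceeds[OF \<mu> _ j(3) a c1 c2 start]) simp
        from lim_normalized_mean_ge[OF \<mu> nn_expect_initial_law[OF Q fin p] a_def this]
        show "1 / m ^ (3 * (L * nat \<lceil>real L powr \<delta>\<rceil>)) \<le> free_energy N Q p" by (simp add: free_energy_eq_lim j_def)
      qed
    qed
  qed
qed

lemma free_energy_le:
  assumes Q: "nonneg_law Q" and fin: "nn_expect Q < \<infinity>" and c: "0 \<le> c" and \<beta>: "\<alpha> + 2 < \<beta>" "0 < \<beta>"
    and tail: "\<And>k. 1 \<le> k \<Longrightarrow> measure Q {real k..} \<le> c * real k powr \<alpha> * m powr - real k"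
  shows "\<exists>b>0. \<forall>\<^sub>F L in sequentially. \<forall>p\<in>{0..1}. b * p * real L powr \<beta> \<le> 1 \<longrightarrow> free_energy N Q p \<le> 1 / m ^ L"
proof -
  obtain b where b: "0 < b" and ub: "\<And>L::nat. 1 \<le> L \<Longrightarrow> 1 < m * exp (- 1 / real L) \<Longrightarrow>
    (\<integral>\<^sup>+x. ennreal (moment_fun (m * exp (- 1 / real L)) x) \<partial>Q) \<le> ennreal (b * real L powr \<beta>)"
    using moment_upper_bound[OF Q m_gt_1 c \<beta> tail] by blast
  obtain \<delta> where \<delta>: "0 < \<delta>" and step: "\<And>\<mu> (L::nat). nonneg_law \<mu> \<Longrightarrow> nn_expect \<mu> < \<infinity> \<Longrightarrow> 1 < m * exp (- 1 / real L) \<Longrightarrow> 1 \<le> L \<Longrightarrow>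
     (\<integral>\<^sup>+x. ennreal (moment_fun (m * exp (- 1 / real L)) x) \<partial>\<mu>) \<le> ennreal \<delta> \<Longrightarrow>
     lim (normalized_mean \<mu>) \<le> 1 / m ^ L"
    using lim_normalized_mean_le by blast
  have sQ: "sets Q = sets borel" using Q by (simp_all add: nonneg_law_def)
  have "(\<lambda>L. m * exp (- 1 / real L)) \<longlonglongrightarrow> m * exp 0" by (intro tendsto_intros)
  then have ev: "\<forall>\<^sub>F L in sequentially. 1 < m * exp (- 1 / real L)"
    by (rule order_tendstoD) (use m_gt_1 in simp)
  show ?thesis
  proof (intro exI[of _ "b / \<delta>"] conjI)
    show "0 < b / \<delta>" using b \<delta> by simp
    show "\<forall>\<^sub>F L in sequentially. \<forall>p\<in>{0..1}. b / \<delta> * p * real L powr \<beta> \<le> 1 \<longrightarrow> free_energy N Q p \<le> 1 / m ^ L"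
      using ev eventually_gt_at_top[of 0]
    proof eventually_elim
      case (elim L)
      show ?case
      proof (intro ballI impI)
        fix p :: real assume p: "p \<in> {0..1}" and prem: "b / \<delta> * p * real L powr \<beta> \<le> 1"
        let ?s = "m * exp (- 1 / real L)" and ?\<mu> = "initial_law Q p"
        have "(\<integral>\<^sup>+x. ennreal (moment_fun ?s x) \<partial>?\<mu>) = ennreal p * (\<integral>\<^sup>+x. ennreal (moment_fun ?s x) \<partial>Q)"
          by (subst nn_integral_initial_law[OF sQ p]) (auto simp: moment_fun_def)
        also have "\<dots> \<le> ennreal p * ennreal (b * real L powr \<beta>)"
          using elim by (intro mult_left_mono ub) auto
        also have "\<dots> = ennreal (p * (b * real L powr \<beta>))" using p b by (simp add: ennreal_mult)
        also have "\<dots> \<le> ennreal \<delta>" using prem \<delta> by (intro ennreal_leI) (simp add: field_simps)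
        finally show "free_energy N Q p \<le> 1 / m ^ L" unfolding free_energy_eq_lim
          using elim by (intro step nonneg_law_initial_law[OF Q p] nn_expect_initial_law[OF Q fin p]) auto
      qed
    qed
  qed
qed

text \<open>The mean is at most the moment at any \<open>s > 1\<close>, and one \<open>L\<close>
  with \<open>1 < m * exp (- 1 / real L)\<close> suffices; the particular \<open>\<beta>\<close> is
  immaterial.\<close>

lemma nn_expect_finite:
  assumes Q: "nonneg_law Q" and c: "0 \<le> c"
    and tail: "\<And>k. 1 \<le> k \<Longrightarrow> measure Q {real k..} \<le> c * real k powr \<alpha> * m powr - real k"
  shows "nn_expect Q < \<infinity>"
proof -
  define \<beta> where "\<beta> = max 1 (\<alpha> + 3)"
  have \<beta>: "\<alpha> + 2 < \<beta>" "0 < \<beta>" by (auto simp: \<beta>_def)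
  obtain b where b: "0 < b" and ub: "\<And>L::nat. 1 \<le> L \<Longrightarrow> 1 < m * exp (- 1 / real L) \<Longrightarrow>
    (\<integral>\<^sup>+x. ennreal (moment_fun (m * exp (- 1 / real L)) x) \<partial>Q) \<le> ennreal (b * real L powr \<beta>)"
    using moment_upper_bound[OF Q m_gt_1 c \<beta> tail] by blast
  have nn: "AE x in Q. 0 \<le> x" using Q by (simp add: nonneg_law_def)
  have "(\<lambda>L. m * exp (- 1 / real L)) \<longlonglongrightarrow> m * exp 0" by (intro tendsto_intros)
  then have "\<forall>\<^sub>F L in sequentially. 1 < m * exp (- 1 / real L)"
    by (rule order_tendstoD) (use m_gt_1 in simp)
  with eventually_ge_at_top[of 1] have "\<forall>\<^sub>F L in sequentially. 1 \<le> L \<and> 1 < m * exp (- 1 / real L)"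
    by (rule eventually_conj)
  then obtain L :: nat where L: "1 \<le> L" "1 < m * exp (- 1 / real L)"
    by (auto simp: eventually_sequentially)
  have "nn_expect Q \<le> (\<integral>\<^sup>+x. ennreal (moment_fun (m * exp (- 1 / real L)) x) \<partial>Q)"
  proof (intro nn_integral_mono_AE, use nn in eventually_elim)
    case (elim x)
    have "x * 1 \<le> x * (m * exp (- 1 / real L)) powr x"
      using elim L by (intro mult_left_mono ge_one_powr_ge_zero) auto
    then show ?case by (simp add: moment_fun_def ennreal_leI)
  qed
  also have "\<dots> \<le> ennreal (b * real L powr \<beta>)" by (rule ub[OF L])
  also have "\<dots> < \<infinity>" by simp
  finally show ?thesis .
qed

end

section \<open>Asymptotics as \<open>p\<close> tends to \<open>0\<close>\<close>

lemma eventually_le_inverse_powr: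
  fixes K d :: real
  assumes "0 < d"
  shows "\<forall>\<^sub>F p in at_right 0. K \<le> p powr - d"
proof -
  have "filterlim (\<lambda>p::real. p powr - d) at_top (at_right 0)" using assms by real_asymp
  then show ?thesis by (simp add: filterlim_at_top)
qed

text \<open>\<open>eps\<close> is obtained by solving the required identity for the exponent. Taking
  logarithms twice turns the two bounds on \<open>F\<close> into bounds on
  \<open>eps\<close>.\<close>

lemma exponent_from_bounds:
  fixes F :: "real \<Rightarrow> real" and \<xi> :: real
  assumes lower: "\<And>\<epsilon>. 0 < \<epsilon> \<Longrightarrow> \<forall>\<^sub>F p in at_right 0. exp (- (p powr - (\<xi> + \<epsilon>))) \<le> F p"
    and upper: "\<And>\<epsilon>. 0 < \<epsilon> \<Longrightarrow> \<forall>\<^sub>F p in at_right 0. F p \<le> exp (- (p powr - (\<xi> - \<epsilon>)))"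
  shows "\<exists>eps :: real \<Rightarrow> real. (eps \<longlongrightarrow> 0) (at_right 0) \<and>
    (\<forall>\<^sub>F p in at_right 0. F p = exp (- (1 / p powr (\<xi> + eps p))))"
proof -
  define eps where "eps p = ln (- ln (F p)) / (- ln p) - \<xi>" for p
  have p01: "\<forall>\<^sub>F p in at_right (0::real). 0 < p \<and> p < 1"
    unfolding eventually_at_right_field by (intro exI[of _ 1]) auto
  have bounds: "\<forall>\<^sub>F p in at_right 0. 0 < F p \<and> p powr - (\<xi> - \<epsilon>) \<le> - ln (F p) \<and> - ln (F p) \<le> p powr - (\<xi> + \<epsilon>)"
    if "0 < \<epsilon>" for \<epsilon>
    using lower[OF that] upper[OF that]
  proof eventually_elim
    case (elim p)
    have F0: "0 < F p" using elim(1) exp_gt_zero less_le_trans by blast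
    with elim have "ln (exp (- (p powr - (\<xi> + \<epsilon>)))) \<le> ln (F p)" "ln (F p) \<le> ln (exp (- (p powr - (\<xi> - \<epsilon>))))"
      by (simp_all only: ln_le_cancel_iff exp_gt_zero)
    with F0 show ?case by simp
  qed
  have "(eps \<longlongrightarrow> 0) (at_right 0)"
  proof (rule tendstoI)
    fix e :: real assume e: "0 < e"
    show "\<forall>\<^sub>F p in at_right 0. dist (eps p) 0 < e"
      using bounds[OF half_gt_zero[OF e]] p01
    proof eventually_elim
      case (elim p)
      have p: "0 < p" "0 < - ln p" using elim by simp_all
      have "0 < p powr - (\<xi> - e / 2)" using p by simp
      then have F: "0 < - ln (F p)" using elim by linarith
      have "ln (p powr - (\<xi> - e / 2)) \<le> ln (- ln (F p))" "ln (- ln (F p)) \<le> ln (p powr - (\<xi> + e / 2))"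
        using elim p F by (simp_all only: ln_le_cancel_iff powr_gt_zero)
      then have "(\<xi> - e / 2) * (- ln p) \<le> ln (- ln (F p))" "ln (- ln (F p)) \<le> (\<xi> + e / 2) * (- ln p)"
        using p by (simp_all add: ln_powr algebra_simps)
      then have "\<xi> - e / 2 \<le> ln (- ln (F p)) / (- ln p)" "ln (- ln (F p)) / (- ln p) \<le> \<xi> + e / 2"
        using p by (simp_all only: pos_le_divide_eq pos_divide_le_eq)
      then show ?case using e by (simp only: eps_def dist_real_def)
    qed
  qed
  \<comment> \<open>One fixed \<open>\<epsilon>\<close> is enough here, since only
    \<open>0 < F p < 1\<close> is used, which makes both logarithms meaningful.\<close>
  moreover have "\<forall>\<^sub>F p in at_right 0. F p = exp (- (1 / p powr (\<xi> + eps p)))"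
    using bounds[OF zero_less_one] p01
  proof eventually_elim
    case (elim p)
    have p: "0 < p" "ln p < 0" using elim by simp_all
    have "0 < p powr - (\<xi> - 1)" using p by simp
    moreover have "p powr - (\<xi> - 1) \<le> - ln (F p)" using elim by blast
    ultimately have F: "0 < - ln (F p)" by linarith
    have "p powr (\<xi> + eps p) = exp (- ln (- ln (F p)))" using p by (simp add: eps_def powr_def)
    also have "\<dots> = 1 / (- ln (F p))" using F by (simp only: exp_minus exp_ln inverse_eq_divide)
    finally show ?case using F elim by simp
  qed
  ultimately show ?thesis by blast
qed

text \<open>The scale \<open>L\<close> is about \<open>p powr - \<kappa>\<close> with
  \<open>\<kappa>\<close> above the critical exponent by \<open>\<epsilon> / 2\<close>, so that p
  L^(alpha+2) tends to infinity and eventually passes the threshold. The other half of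
  \<open>\<epsilon>\<close> pays for \<open>j\<close> and for constants.\<close>

lemma asymptotic_lower_bound:
  fixes F :: "real \<Rightarrow> real" and m \<alpha> \<epsilon> :: real
  assumes m: "1 < m" and \<alpha>: "- 2 < \<alpha>" and \<epsilon>: "0 < \<epsilon>"
    and F: "\<And>\<delta>. 0 < \<delta> \<Longrightarrow> \<exists>b>0. \<forall>\<^sub>F L in sequentially. \<forall>p\<in>{0..1}. 1 \<le> b * p * real L powr (\<alpha> + 2) \<longrightarrow>
      1 / m ^ (3 * (L * nat \<lceil>real L powr \<delta>\<rceil>)) \<le> F p"
  shows "\<forall>\<^sub>F p in at_right 0. exp (- (p powr - (1 / (\<alpha> + 2) + \<epsilon>))) \<le> F p"
proof -
  define \<xi> where "\<xi> = 1 / (\<alpha> + 2)"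
  define \<kappa> where "\<kappa> = \<xi> + \<epsilon> / 2"
  \<comment> \<open>Makes \<open>real L powr \<delta>\<close> of order
    \<open>p powr - (\<epsilon> / 4)\<close>; the last quarter of \<open>\<epsilon>\<close> absorbs
    \<open>12 * ln m * 2 powr \<delta>\<close>.\<close>
  define \<delta> where "\<delta> = \<epsilon> / (4 * \<kappa>)"
  have \<xi>: "0 < \<xi>" "\<xi> * (\<alpha> + 2) = 1" using \<alpha> by (auto simp: \<xi>_def)
  have \<kappa>: "0 < \<kappa>" using \<xi> \<epsilon> by (simp add: \<kappa>_def)
  have \<delta>: "0 < \<delta>" "\<kappa> * \<delta> = \<epsilon> / 4" using \<kappa> \<epsilon> by (auto simp: \<delta>_def)
  obtain b where b: "0 < b" and ev: "\<forall>\<^sub>F L in sequentially. \<forall>p\<in>{0..1}. 1 \<le> b * p * real L powr (\<alpha> + 2) \<longrightarrow>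
      1 / m ^ (3 * (L * nat \<lceil>real L powr \<delta>\<rceil>)) \<le> F p"
    using F[OF \<delta>(1)] by blast
  define L where "L p = nat \<lceil>p powr - \<kappa>\<rceil>" for p :: real
  have limL: "filterlim L sequentially (at_right 0)"
    unfolding filterlim_at_top
  proof
    fix Z :: nat
    show "\<forall>\<^sub>F p in at_right 0. Z \<le> L p"
      using eventually_le_inverse_powr[OF \<kappa>, of "real Z"]
      by eventually_elim (auto simp: L_def le_nat_iff le_ceiling_iff)
  qed
  have evL: "\<forall>\<^sub>F p in at_right 0. \<forall>p'\<in>{0..1}. 1 \<le> b * p' * real (L p) powr (\<alpha> + 2) \<longrightarrow>
      1 / m ^ (3 * (L p * nat \<lceil>real (L p) powr \<delta>\<rceil>)) \<le> F p'"
    by (rule eventually_compose_filterlim[OF ev limL])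
  have p01: "\<forall>\<^sub>F p in at_right (0::real). 0 < p \<and> p < 1"
    unfolding eventually_at_right_field by (intro exI[of _ 1]) auto
  have d: "0 < \<epsilon> / 2 * (\<alpha> + 2)" "0 < \<epsilon> / 4" using \<epsilon> \<alpha> by auto
  show ?thesis
    using evL p01 eventually_le_inverse_powr[OF d(1), of "1 / b"]
      eventually_le_inverse_powr[OF d(2), of "12 * ln m * 2 powr \<delta>"]
      eventually_le_inverse_powr[OF \<kappa>, of 1]
  proof eventually_elim
    case (elim p)
    define j where "j = nat \<lceil>real (L p) powr \<delta>\<rceil>"
    let ?x = "p powr - \<kappa>"
    have Lx: "?x \<le> real (L p)" "real (L p) \<le> 2 * ?x" "1 \<le> real (L p)"
      using elim(5) unfolding L_def by linarith+
    have "1 \<le> real (L p) powr \<delta>" using Lx \<delta> by (intro ge_one_powr_ge_zero) auto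
    then have "real j \<le> 2 * real (L p) powr \<delta>" unfolding j_def by linarith
    also have "\<dots> \<le> 2 * (2 * ?x) powr \<delta>" using Lx \<delta> by (intro mult_left_mono powr_mono2) auto
    also have "(2 * ?x) powr \<delta> = 2 powr \<delta> * ?x powr \<delta>" by (simp add: powr_mult)
    also have "?x powr \<delta> = p powr - (\<epsilon> / 4)" by (simp only: powr_powr mult_minus_left \<delta>(2))
    also have "2 * (2 powr \<delta> * p powr - (\<epsilon> / 4)) = 2 * 2 powr \<delta> * p powr - (\<epsilon> / 4)" by simp
    finally have j: "real j \<le> 2 * 2 powr \<delta> * p powr - (\<epsilon> / 4)" .
    have "1 / b * b \<le> p powr - (\<epsilon> / 2 * (\<alpha> + 2)) * b" using elim(3) b by (intro mult_right_mono) auto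
    also have "- (\<epsilon> / 2 * (\<alpha> + 2)) = 1 + - \<kappa> * (\<alpha> + 2)" using \<xi>(2) by (simp add: \<kappa>_def algebra_simps)
    also have "p powr \<dots> * b = b * p * p powr (- \<kappa> * (\<alpha> + 2))"
      unfolding powr_add[of p 1] using elim by simp
    also have "p powr (- \<kappa> * (\<alpha> + 2)) = ?x powr (\<alpha> + 2)" by (simp only: powr_powr)
    also have "b * p * ?x powr (\<alpha> + 2) \<le> b * p * real (L p) powr (\<alpha> + 2)"
      using Lx b elim \<alpha> by (intro mult_left_mono powr_mono2) auto
    finally have "1 \<le> b * p * real (L p) powr (\<alpha> + 2)" using b by simp
    then have "1 / m ^ (3 * (L p * j)) \<le> F p" using elim by (simp add: j_def)
    moreover have "1 / m ^ (3 * (L p * j)) = exp (- (3 * ln m * (real (L p) * real j)))"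
    proof -
      have "m ^ (3 * (L p * j)) = exp (ln m * real (3 * (L p * j)))"
        using m by (simp flip: powr_realpow add: powr_def mult.commute)
      then show ?thesis by (simp add: exp_minus field_simps)
    qed
    moreover have "3 * ln m * (real (L p) * real j) \<le> p powr - (\<xi> + \<epsilon>)"
    proof -
      have "3 * ln m * (real (L p) * real j) \<le> 3 * ln m * (2 * ?x * (2 * 2 powr \<delta> * p powr - (\<epsilon> / 4)))"
        using Lx j m by (intro mult_left_mono mult_mono) auto
      also have "\<dots> = (12 * ln m * 2 powr \<delta>) * (p powr (- \<kappa>) * p powr - (\<epsilon> / 4))" by simp
      also have "\<dots> \<le> p powr - (\<epsilon> / 4) * (p powr (- \<kappa>) * p powr - (\<epsilon> / 4))"
        using elim(4) by (intro mult_right_mono) auto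
      also have "\<dots> = p powr - (\<xi> + \<epsilon>)"
      proof -
        have "- (\<epsilon> / 4) + (- \<kappa> + - (\<epsilon> / 4)) = - (\<xi> + \<epsilon>)" by (simp add: \<kappa>_def)
        then show ?thesis by (simp only: powr_add[symmetric])
      qed
      finally show ?thesis .
    qed
    ultimately show ?case unfolding \<xi>_def[symmetric] by (smt (verit) exp_le_cancel_iff)
  qed
qed

text \<open>Now \<open>\<kappa>\<close> lies below the critical exponent, which leaves room for a
  \<open>\<beta>\<close> between \<open>\<alpha> + 2\<close> and \<open>1 / \<kappa>\<close>. Then p
  L^beta is at most p^(1 - kappa beta), which tends to 0, and the other half of \<open>e\<close>
  absorbs the factor \<open>ln m / 2\<close>.\<close>

lemma asymptotic_upper_bound:
  fixes F :: "real \<Rightarrow> real" and m \<alpha> \<epsilon> :: real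
  assumes m: "1 < m" and \<alpha>: "- 2 < \<alpha>" and \<epsilon>: "0 < \<epsilon>"
    and F: "\<And>\<beta>. \<alpha> + 2 < \<beta> \<Longrightarrow> \<exists>b>0. \<forall>\<^sub>F L in sequentially. \<forall>p\<in>{0..1}. b * p * real L powr \<beta> \<le> 1 \<longrightarrow> F p \<le> 1 / m ^ L"
  shows "\<forall>\<^sub>F p in at_right 0. F p \<le> exp (- (p powr - (1 / (\<alpha> + 2) - \<epsilon>)))"
proof -
  define \<xi> where "\<xi> = 1 / (\<alpha> + 2)"
  have \<xi>: "0 < \<xi>" "\<xi> * (\<alpha> + 2) = 1" using \<alpha> by (auto simp: \<xi>_def)
  \<comment> \<open>Shrinking \<open>\<epsilon>\<close> to at most half the critical exponent keeps
    \<open>\<kappa>\<close> positive, so that \<open>L p\<close> tends to infinity.\<close>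
  define e where "e = min \<epsilon> (\<xi> / 2)"
  have e: "0 < e" "e \<le> \<epsilon>" "e < \<xi>" using \<epsilon> \<xi> by (auto simp: e_def)
  define \<kappa> where "\<kappa> = \<xi> - e / 2"
  have \<kappa>: "0 < \<kappa>" using e \<xi> by (simp add: \<kappa>_def)
  have "\<kappa> * (\<alpha> + 2) < \<xi> * (\<alpha> + 2)" using e \<alpha> by (intro mult_strict_right_mono) (auto simp: \<kappa>_def)
  then have "\<alpha> + 2 < 1 / \<kappa>" using \<xi> \<kappa> by (simp add: field_simps)
  then obtain \<beta> where \<beta>: "\<alpha> + 2 < \<beta>" "\<beta> < 1 / \<kappa>" using dense by blast
  have d: "0 < 1 - \<kappa> * \<beta>" using \<beta> \<kappa> by (simp add: field_simps)
  obtain b where b: "0 < b" and ev: "\<forall>\<^sub>F L in sequentially. \<forall>p\<in>{0..1}. b * p * real L powr \<beta> \<le> 1 \<longrightarrow> F p \<le> 1 / m ^ L"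
    using F[OF \<beta>(1)] by blast
  define L where "L p = nat \<lfloor>p powr - \<kappa>\<rfloor>" for p :: real
  have limL: "filterlim L sequentially (at_right 0)"
    unfolding filterlim_at_top
  proof
    fix Z :: nat
    show "\<forall>\<^sub>F p in at_right 0. Z \<le> L p"
      using eventually_le_inverse_powr[OF \<kappa>, of "real Z"]
      by eventually_elim (auto simp: L_def le_nat_iff le_floor_iff)
  qed
  have evL: "\<forall>\<^sub>F p in at_right 0. \<forall>p'\<in>{0..1}. b * p' * real (L p) powr \<beta> \<le> 1 \<longrightarrow> F p' \<le> 1 / m ^ L p"
    by (rule eventually_compose_filterlim[OF ev limL])
  have p01: "\<forall>\<^sub>F p in at_right (0::real). 0 < p \<and> p < 1"
    unfolding eventually_at_right_field by (intro exI[of _ 1]) auto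
  have e2: "0 < e / 2" using e by simp
  show ?thesis
    using evL p01 eventually_le_inverse_powr[OF d, of b]
      eventually_le_inverse_powr[OF e2, of "2 / ln m"]
      eventually_le_inverse_powr[OF \<kappa>, of 2]
  proof eventually_elim
    case (elim p)
    let ?x = "p powr - \<kappa>"
    have Lx: "real (L p) \<le> ?x" "?x / 2 \<le> real (L p)"
      using elim(5) unfolding L_def by linarith+
    have "b * p * real (L p) powr \<beta> \<le> b * p * ?x powr \<beta>"
      using Lx b elim \<beta> \<alpha> by (intro mult_left_mono powr_mono2) auto
    also have "?x powr \<beta> = p powr - (\<kappa> * \<beta>)" by (simp only: powr_powr mult_minus_left)
    also have "b * p * p powr - (\<kappa> * \<beta>) = b * p powr (1 - \<kappa> * \<beta>)"
      using elim powr_add[of p 1 "- (\<kappa> * \<beta>)"] by simp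
    also have "\<dots> \<le> p powr - (1 - \<kappa> * \<beta>) * p powr (1 - \<kappa> * \<beta>)"
      using elim(3) by (intro mult_right_mono) auto
    also have "\<dots> = 1" using elim by (simp flip: powr_add)
    finally have "F p \<le> 1 / m ^ L p" using elim by auto
    also have "\<dots> = exp (- (ln m * real (L p)))"
    proof -
      have "m ^ L p = exp (ln m * real (L p))"
        using m by (simp flip: powr_realpow add: powr_def mult.commute)
      then show ?thesis by (simp add: exp_minus field_simps)
    qed
    also have "\<dots> \<le> exp (- (p powr - (\<xi> - \<epsilon>)))"
    proof -
      have "p powr - (\<xi> - \<epsilon>) \<le> p powr - (\<xi> - e)" using elim e by (intro powr_mono') auto
      also have "\<dots> * 1 \<le> p powr - (\<xi> - e) * (ln m / 2 * p powr - (e / 2))"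
        using elim(4) m by (intro mult_left_mono) (auto simp: field_simps)
      also have "\<dots> = ln m / 2 * (p powr - (\<xi> - e) * p powr - (e / 2))" by simp
      also have "p powr - (\<xi> - e) * p powr - (e / 2) = ?x" by (simp add: \<kappa>_def flip: powr_add)
      also have "ln m / 2 * ?x \<le> ln m * real (L p)" using mult_left_mono[OF Lx(2), of "ln m"] m by simp
      finally show ?thesis by simp
    qed
    finally show ?case unfolding \<xi>_def .
  qed
qed

theorem theorem1p5:
  fixes M :: "'a measure" and nu :: "'a \<Rightarrow> nat" and Y0 :: "'a \<Rightarrow> real"
    and alpha m chi c3 c4 t :: real
    and N :: "nat measure" and Q :: "real measure"
  defines "N \<equiv> distr M (count_space UNIV) nu"
    and "Q \<equiv> distr M borel Y0"
    and "m \<equiv> (\<integral>\<omega>. real (nu \<omega>) \<partial>M)"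
    and "chi \<equiv> 1 / (alpha + 2)"
  assumes "alpha > - 2"
    and "prob_space M"
    and "nu \<in> M \<rightarrow>\<^sub>M count_space UNIV"
    and "\<And>\<omega>. \<omega> \<in> space M \<Longrightarrow> nu \<omega> \<ge> 1"
    and "t > 1" and "integrable M (\<lambda>\<omega>. t ^ nu \<omega>)"
    and "m > 1"
    and "Y0 \<in> borel_measurable M"
    and "\<And>\<omega>. \<omega> \<in> space M \<Longrightarrow> Y0 \<omega> > 0"
    and "0 < c3" and "c3 \<le> c4"
    and "\<forall>\<^sub>F x in at_top.
           c3 * x powr alpha * m powr (- x) \<le> measure M {\<omega> \<in> space M. Y0 \<omega> \<ge> x} \<and>
           measure M {\<omega> \<in> space M. Y0 \<omega> \<ge> x} \<le> c4 * x powr alpha * m powr (- x)"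
  shows "critical_parameter N Q = 0 \<and>
    (\<exists>eps :: real \<Rightarrow> real. (eps \<longlongrightarrow> 0) (at_right 0) \<and>
       (\<forall>\<^sub>F p in at_right 0. free_energy N Q p = exp (- (1 / p powr (chi + eps p)))))"
proof -
  note [measurable] = assms(7) \<open>Y0 \<in> borel_measurable M\<close>
  interpret M: prob_space M by fact
  have m1: "1 < m" by fact
  \<comment> \<open>The Bochner integral of a non-integrable function is 0, which contradicts
    \<open>m > 1\<close>.\<close>
  have int_nu: "integrable M (\<lambda>\<omega>. real (nu \<omega>))"
  proof (rule ccontr)
    assume "\<not> ?thesis"
    then have "m = 0" unfolding m_def by (rule not_integrable_integral_eq)
    then show False using m1 by simp
  qed
  interpret offspring_law N m t
  proof (intro offspring_law.intro offspring_law_axioms.intro)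
    show "prob_space N" unfolding N_def by (rule M.prob_space_distr) fact
    show "sets N = UNIV" by (simp add: N_def)
    show "AE k in N. 1 \<le> k" unfolding N_def using assms(8) by (subst AE_distr_iff) (auto intro!: AE_I2)
    show "integrable N real" unfolding N_def using int_nu by (subst integrable_distr_eq) auto
    show "(\<integral>k. real k \<partial>N) = m" unfolding N_def m_def by (subst integral_distr) auto
    show "integrable N (\<lambda>k. t ^ k)" unfolding N_def using assms(10) by (subst integrable_distr_eq) auto
  qed fact+
  have Q: "nonneg_law Q"
    unfolding nonneg_law_def Q_def
    by (auto intro!: M.prob_space_distr simp: AE_distr_iff intro: less_imp_le assms(13))
  interpret Q: prob_space Q using Q by (simp add: nonneg_law_def)
  have measure_Q: "measure Q {x..} = measure M {\<omega> \<in> space M. Y0 \<omega> \<ge> x}" for x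
    unfolding Q_def by (subst measure_distr) (auto intro!: arg_cong[where f = "measure M"])
  obtain x0 where x0: "\<And>x. x0 \<le> x \<Longrightarrow> c3 * x powr alpha * m powr (- x) \<le> measure Q {x..}"
    "\<And>x. x0 \<le> x \<Longrightarrow> measure Q {x..} \<le> c4 * x powr alpha * m powr (- x)"
    using assms(16) unfolding eventually_at_top_linorder measure_Q by blast
  define k0 where "k0 = nat \<lceil>x0\<rceil>"
  have k0: "x0 \<le> real k" if "k0 \<le> k" for k using that unfolding k0_def by linarith
  have lower: "c3 * real k powr alpha * m powr - real k \<le> measure Q {real k..}" if "k0 \<le> k" for k
    using x0(1) k0 that by auto
  define w where "w k = real k powr alpha * m powr - real k" for k :: nat
  \<comment> \<open>Extends the upper tail bound from large \<open>k\<close> to all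
    \<open>k \<ge> 1\<close>: for the finitely many \<open>k < k0\<close> the measure is at most
    \<open>1 = 1 / w k * w k\<close>. The term \<open>k = 0\<close> is harmless, since division by 0
    gives 0.\<close>
  define c where "c = c4 + (\<Sum>k<k0. 1 / w k)"
  have w: "0 \<le> w k" for k by (simp add: w_def)
  have c: "0 \<le> c" unfolding c_def using assms(14,15) w by (intro add_nonneg_nonneg sum_nonneg) auto
  have upper: "measure Q {real k..} \<le> c * real k powr alpha * m powr - real k" if k: "1 \<le> k" for k
  proof (cases "k0 \<le> k")
    case True
    then have "measure Q {real k..} \<le> c4 * w k" using x0(2) k0 by (auto simp: w_def mult.assoc)
    also have "\<dots> \<le> c * w k" unfolding c_def using w by (intro mult_right_mono) (auto intro!: sum_nonneg)
    finally show ?thesis by (simp add: w_def mult.assoc)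
  next
    case False
    have "0 < w k" using k m1 by (simp add: w_def)
    then have "measure Q {real k..} \<le> 1 / w k * w k" by simp
    also have "1 / w k \<le> (\<Sum>k<k0. 1 / w k)" using False w by (intro member_le_sum) auto
    then have "1 / w k * w k \<le> c * w k" unfolding c_def using w assms(14,15) by (intro mult_right_mono) auto
    finally show ?thesis by (simp add: w_def mult.assoc)
  qed
  have fin: "nn_expect Q < \<infinity>" by (rule nn_expect_finite[OF Q c upper])
  have ge: "\<exists>b>0. \<forall>\<^sub>F L in sequentially. \<forall>p\<in>{0..1}. 1 \<le> b * p * real L powr (alpha + 2) \<longrightarrow>
      1 / m ^ (3 * (L * nat \<lceil>real L powr \<delta>\<rceil>)) \<le> free_energy N Q p" if "0 < \<delta>" for \<delta>
    by (rule free_energy_ge[OF Q fin \<open>0 < c3\<close> that lower])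
  have le: "\<exists>b>0. \<forall>\<^sub>F L in sequentially. \<forall>p\<in>{0..1}. b * p * real L powr \<beta> \<le> 1 \<longrightarrow> free_energy N Q p \<le> 1 / m ^ L"
    if "alpha + 2 < \<beta>" for \<beta>
    using \<open>- 2 < alpha\<close> that by (intro free_energy_le[OF Q fin c that _ upper]) auto
  \<comment> \<open>For fixed \<open>p > 0\<close> the condition on p L^(alpha+2) holds for all
    large \<open>L\<close>, and one such \<open>L\<close> gives positivity.\<close>
  have pos: "0 < free_energy N Q p" if p: "p \<in> {0..1}" "0 < p" for p
  proof -
    obtain b where b: "0 < b" and ev: "\<forall>\<^sub>F L in sequentially. \<forall>p\<in>{0..1}. 1 \<le> b * p * real L powr (alpha + 2) \<longrightarrow>
      1 / m ^ (3 * (L * nat \<lceil>real L powr 1\<rceil>)) \<le> free_energy N Q p"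
      using ge[of 1] by auto
    have bp: "0 < b * p" "0 < alpha + 2" using b p \<open>- 2 < alpha\<close> by auto
    have "filterlim (\<lambda>L. b * p * real L powr (alpha + 2)) at_top sequentially"
      using bp by real_asymp
    then have "\<forall>\<^sub>F L in sequentially. 1 \<le> b * p * real L powr (alpha + 2)" by (simp add: filterlim_at_top)
    with ev have "\<forall>\<^sub>F L in sequentially. 1 / m ^ (3 * (L * nat \<lceil>real L powr 1\<rceil>)) \<le> free_energy N Q p"
      by eventually_elim (use p in auto)
    then obtain L where "1 / m ^ (3 * (L * nat \<lceil>real L powr 1\<rceil>)) \<le> free_energy N Q p"
      by (auto simp: eventually_sequentially)
    moreover have "0 < 1 / m ^ (3 * (L * nat \<lceil>real L powr 1\<rceil>))" using m1 by simp
    ultimately show ?thesis by linarith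
  qed
  have "critical_parameter N Q = 0"
    unfolding critical_parameter_def
  proof (rule the_equality)
    show "0 \<in> {0..1::real} \<and> (\<forall>p\<in>{0..1}. (0 < p \<longrightarrow> 0 < free_energy N Q p) \<and> (p < 0 \<longrightarrow> free_energy N Q p = 0))"
      using pos by auto
  next
    fix c :: real
    assume c: "c \<in> {0..1} \<and> (\<forall>p\<in>{0..1}. (c < p \<longrightarrow> 0 < free_energy N Q p) \<and> (p < c \<longrightarrow> free_energy N Q p = 0))"
    show "c = 0"
    proof (rule ccontr)
      assume "c \<noteq> 0"
      \<comment> \<open>A positive candidate would force the free energy to vanish at
        \<open>c / 2\<close>.\<close>
      with c have "c / 2 \<in> {0..1}" "0 < c / 2" "c / 2 < c" by auto
      with c pos[of "c / 2"] show False by force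
    qed
  qed
  moreover have "\<exists>eps :: real \<Rightarrow> real. (eps \<longlongrightarrow> 0) (at_right 0) \<and>
       (\<forall>\<^sub>F p in at_right 0. free_energy N Q p = exp (- (1 / p powr (chi + eps p))))"
    unfolding chi_def
    by (intro exponent_from_bounds asymptotic_lower_bound[OF m1 \<open>- 2 < alpha\<close> _ ge]
        asymptotic_upper_bound[OF m1 \<open>- 2 < alpha\<close> _ le])
  ultimately show ?thesis by blast
qed

end
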